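(* Let $A\in\mathbb{R}^{n\times n}$ be such that the only possible eigenvalue of $A$ on the imaginary axis is zero, and zero, if it is an eigenvalue, is semisimple (all Jordan blocks for the eigenvalue $0$ have size one). Then the problems (a) minimize $-\log\det W_\infty(p)$ subject to $p\in\Delta$, $W_\infty(p)\succ O$, and (b) minimize $-\log\det V(p)$ subject to $p\in\Delta$, $V(p)\succ O$ are equivalent in the sense that they share the same set of optimal solutions. If, in addition, $A$ has at least one eigenvalue with negative real part, then the problems (c) minimize $\mathrm{tr}\bigl(Q^{-*}\,\mathrm{diag}(W_-(p)^{-1},O,O)\,Q^{-1}\bigr)$ subject to $p\in\Delta$, $W_-(p)\succ O$, and (d) minimize $\mathrm{tr}\bigl(V_-(p)^{-1}\bigr)$ subject to $p\in\Delta$, $V_-(p)\succ O$ are also equivalent in the same sense.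
   Context: Notation: $\Delta=\{p\in\mathbb{R}^n\mid p_i\ge0,\ \sum_ip_i=1\}$; $X\succ O$ means $X$ is Hermitian positive definite; $e_i$ is the $i$-th standard basis vector; $X^*$ is the conjugate transpose, $X^{-*}=(X^{-1})^*$; $\mathrm{diag}$ of square matrices is the block-diagonal matrix; $I_k$ is the identity and $N_k$ is the $k\times k$ nilpotent Jordan block with ones on the superdiagonal. Blocks of size zero are omitted. Jordan form: fix a Jordan decomposition $Q^{-1}AQ=J=\mathrm{diag}(J_1,\dots,J_m)$, $Q\in\mathbb{C}^{n\times n}$ invertible, $J_i=\lambda_iI_{n_i}+N_{n_i}\in\mathbb{C}^{n_i\times n_i}$. Let $m_-,m_0,m_+$ be the numbers of Jordan blocks with $\mathrm{Re}(\lambda_i)<0$, $=0$, $>0$. The blocks are ordered so that $\mathrm{Re}(\lambda_i)<0$ for $i\le m_-$, $\mathrm{Re}(\lambda_i)=0$ for $m_-<i\le m_-+m_0$, $\mathrm{Re}(\lambda_i)>0$ for $i>m_-+m_0$, and $\mathrm{Im}(\lambda_{m_-+1})\le\cdots\le\mathrm{Im}(\lambda_{m_-+m_0})$. Let $n_-,n_0,n_+$ be the total sizes of the blocks in the three groups and $J_-,J_0,J_+$ the corresponding diagonal blocks of $J$. Infinite-horizon scaled Gramian: for $p\in\mathbb{R}^n$ put $\widetilde B=Q^{-1}\mathrm{diag}(p)Q^{-*}$, partitioned as $(\widetilde B_{i,j})_{i,j=1}^m$ with $\widetilde B_{i,j}\in\mathbb{C}^{n_i\times n_j}$, and also as $(\widetilde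 B_{\alpha,\beta})_{\alpha,\beta\in\{-,0,+\}}$ with $\widetilde B_{\alpha,\beta}\in\mathbb{C}^{n_\alpha\times n_\beta}$. Then $W_\infty(p)=\mathrm{diag}(W_-(p),W_0(p),W_+(p))$, where: - $W_-(p)$ and $W_+(p)$ are the unique solutions of $J_-W_-(p)+W_-(p)J_-^*+\widetilde B_{-,-}=O$ and $(-J_+)W_+(p)+W_+(p)(-J_+^* )+\widetilde B_{+,+}=O$. - For $m_-<i,j\le m_-+m_0$, $\widetilde b_{i,j}$ is the $(n_i,n_j)$ (lower-right) entry of $\widetilde B_{i,j}$, and $C_{i,j}\in\mathbb{R}^{n_i\times n_j}$ has $(a,b)$ entry $\frac{1}{(n_i-a)!\,(n_j-b)!\,(n_i-a+n_j-b+1)}$. - $\lambda_1',\dots,\lambda_{m_0'}'$ are the distinct values among $\lambda_{m_-+1},\dots,\lambda_{m_-+m_0}$, ordered by strictly increasing imaginary part, and $m_0^{(\ell)}$ is the number of Jordan blocks with eigenvalue $\lambda_\ell'$. With $\alpha=m_-+m_0^{(1)}+\cdots+m_0^{(\ell-1)}$ and $\beta=\alpha+m_0^{(\ell)}$, $W_0^{(\ell)}(p)$ is the block matrix $(\widetilde b_{i,j}C_{i,j})_{i,j=\alpha+1}^{\beta}$, and $W_0(p)=\mathrm{diag}(W_0^{(1)}(p),\dots,W_0^{(m_0')}(p))$. In $\mathrm{diag}(W_-(p)^{-1},O,O)$ the zero blocks have sizes $n_0\times n_0$ and $n_+\times n_+$. Real-Schur construction: let $R^{(1)}\in\mathbb{R}^{n\times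 n}$ be orthogonal with $$(R^{(1)})^\top A R^{(1)}=\begin{pmatrix} A_- & O & O \\ A_{0,-} & A_0 & O \\ A_{+,-} & A_{+,0} & A_+ \end{pmatrix},$$ where $A_-\in\mathbb{R}^{n_-\times n_-}$, $A_0\in\mathbb{R}^{n_0\times n_0}$, $A_+\in\mathbb{R}^{n_+\times n_+}$ have only eigenvalues with negative, zero, positive real parts, respectively. Let $R^{(2)}_{0,-},R^{(2)}_{+,0},R^{(2)}_{+,-}$ be the unique matrices satisfying $$A_0R^{(2)}_{0,-}-R^{(2)}_{0,-}A_-=-A_{0,-},\quad A_+R^{(2)}_{+,0}-R^{(2)}_{+,0}A_0=-A_{+,0},\quad A_+R^{(2)}_{+,-}-R^{(2)}_{+,-}A_-=-(A_{+,-}+A_{+,0}R^{(2)}_{0,-}),$$ put $$R^{(2)}=\begin{pmatrix} I_{n_-} & O & O \\ R^{(2)}_{0,-} & I_{n_0} & O \\ R^{(2)}_{+,-} & R^{(2)}_{+,0} & I_{n_+} \end{pmatrix},\qquad R=R^{(1)}R^{(2)},$$ so that $R^{-1}AR=\mathrm{diag}(A_-,A_0,A_+)$. Partition $R^{-1}e_i$ into $r_{-,i}\in\mathbb{R}^{n_-}$, $r_{0,i}\in\mathbb{R}^{n_0}$, $r_{+,i}\in\mathbb{R}^{n_+}$. Let $V_{-,i},V_{+,i}$ be the solutions of $A_-V_{-,i}+V_{-,i}A_-^\top+r_{-,i}r_{-,i}^\top=O$ and $(-A_+)V_{+,i}+V_{+,i}(-A_+^\top)+r_{+,i}r_{+,i}^\top=O$,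 and $V_{0,i}=r_{0,i}r_{0,i}^\top$. For $p\in\mathbb{R}^n$, $V_\alpha(p)=\sum_{i=1}^np_iV_{\alpha,i}$ for $\alpha\in\{-,0,+\}$, and $V(p)=\mathrm{diag}(V_-(p),V_0(p),V_+(p))$. *)

theory Defs
  imports
    "Jordan_Normal_Form.Jordan_Normal_Form"
    "Jordan_Normal_Form.Schur_Decomposition"
    "Jordan_Normal_Form.Gauss_Jordan_Elimination"
    Complex_Main
begin

abbreviation cmat :: "real mat \<Rightarrow> complex mat" where
  "cmat \<equiv> map_mat complex_of_real"

text \<open>Unspecified for singular arguments.\<close>
definition minv :: "'a::field mat \<Rightarrow> 'a mat" where
  "minv A = the (mat_inverse A)"

definition mat_trace :: "'a::comm_monoid_add mat \<Rightarrow> 'a" where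
  "mat_trace A = (\<Sum>i<dim_row A. A $$ (i, i))"

definition pos_def :: "complex mat \<Rightarrow> bool" where
  "pos_def X \<longleftrightarrow> square_mat X \<and> mat_adjoint X = X \<and>
     (\<forall>v \<in> carrier_vec (dim_row X). v \<noteq> 0\<^sub>v (dim_row X) \<longrightarrow> Re ((X *\<^sub>v v) \<bullet>c v) > 0)"

definition prob_simplex :: "nat \<Rightarrow> real vec set" where
  "prob_simplex n = {p \<in> carrier_vec n. (\<forall>i<n. 0 \<le> p $ i) \<and> (\<Sum>i<n. p $ i) = 1}"

definition optimal_solutions :: "'a set \<Rightarrow> ('a \<Rightarrow> real) \<Rightarrow> 'a set" where
  "optimal_solutions S f = {p \<in> S. \<forall>q \<in> S. f p \<le> f q}"

text \<open>The solution \<open>X\<close> of \<open>A X + X B + C = O\<close>, meaningful when it exists and is unique,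
  i.e. when \<open>A\<close> and \<open>- B\<close> have no common eigenvalue.
  Lyapunov equations are the case where \<open>B\<close> is the conjugate transpose of \<open>A\<close>.\<close>
definition sylvester_sol :: "'a::field mat \<Rightarrow> 'a mat \<Rightarrow> 'a mat \<Rightarrow> 'a mat" where
  "sylvester_sol A B C = (THE X. X \<in> carrier_mat (dim_row A) (dim_col B) \<and>
     A * X + X * B + C = 0\<^sub>m (dim_row A) (dim_col B))"


subsection \<open>Partitioned vectors and matrices\<close>

text \<open>A partition is given by the list of block sizes; blocks and entries are counted from 0.\<close>
definition block_offset :: "nat list \<Rightarrow> nat \<Rightarrow> nat" where
  "block_offset ns i = sum_list (take i ns)"

definition vec_part :: "nat list \<Rightarrow> 'a vec \<Rightarrow> nat \<Rightarrow> 'a vec" where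
  "vec_part ns v i = vec (ns ! i) (\<lambda>k. v $ (block_offset ns i + k))"

definition mat_part :: "nat list \<Rightarrow> 'a mat \<Rightarrow> nat \<Rightarrow> nat \<Rightarrow> 'a mat" where
  "mat_part ns M i j = mat (ns ! i) (ns ! j)
     (\<lambda>(a, b). M $$ (block_offset ns i + a, block_offset ns j + b))"

text \<open>The block containing the row (or column) with index \<open>a\<close>.\<close>
definition block_index :: "nat list \<Rightarrow> nat \<Rightarrow> nat" where
  "block_index ns a = (LEAST i. a < block_offset ns (Suc i))"

text \<open>The block matrix whose block \<open>(i, j)\<close> is \<open>F i j\<close>, of size \<open>ns ! i\<close> by \<open>ns ! j\<close>.\<close>
definition mat_of_blocks :: "nat list \<Rightarrow> (nat \<Rightarrow> nat \<Rightarrow> 'a mat) \<Rightarrow> 'a mat" where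
  "mat_of_blocks ns F = mat (sum_list ns) (sum_list ns) (\<lambda>(a, b).
     let i = block_index ns a; j = block_index ns b
     in F i j $$ (a - block_offset ns i, b - block_offset ns j))"

text \<open>The block lower triangular matrix with rows
  \<open>(A11, O, O)\<close>, \<open>(A21, A22, O)\<close>, \<open>(A31, A32, A33)\<close>.\<close>
definition lower_block3 ::
  "'a::zero mat \<Rightarrow> 'a mat \<Rightarrow> 'a mat \<Rightarrow> 'a mat \<Rightarrow> 'a mat \<Rightarrow> 'a mat \<Rightarrow> 'a mat" where
  "lower_block3 A11 A21 A22 A31 A32 A33 =
     four_block_mat A11 (0\<^sub>m (dim_row A11) (dim_col A22 + dim_col A33))
       (A21 @\<^sub>r A31)
       (four_block_mat A22 (0\<^sub>m (dim_row A22) (dim_col A33)) A32 A33)"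


subsection \<open>Jordan decomposition\<close>

type_synonym jblocks = "(nat \<times> complex) list"

definition total_size :: "jblocks \<Rightarrow> nat" where
  "total_size bs = sum_list (map fst bs)"

text \<open>The Jordan blocks, as pairs of size and eigenvalue, come in three lists according to the
  sign of the real part. So the numbers of blocks in the groups are \<open>length jm\<close>, \<open>length j0\<close>,
  \<open>length jp\<close>, and the total sizes are \<open>total_size jm\<close>, \<open>total_size j0\<close>, \<open>total_size jp\<close>.\<close>
definition ordered_jordan_decomposition ::
  "nat \<Rightarrow> complex mat \<Rightarrow> complex mat \<Rightarrow> jblocks \<Rightarrow> jblocks \<Rightarrow> jblocks \<Rightarrow> bool" where
  "ordered_jordan_decomposition n A Q jm j0 jp \<longleftrightarrow>
     Q \<in> carrier_mat n n \<and> invertible_mat Q \<and>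
     minv Q * A * Q = jordan_matrix (jm @ j0 @ jp) \<and>
     (\<forall>(k, l) \<in> set (jm @ j0 @ jp). k > 0) \<and>
     (\<forall>(k, l) \<in> set jm. Re l < 0) \<and>
     (\<forall>(k, l) \<in> set j0. Re l = 0) \<and>
     (\<forall>(k, l) \<in> set jp. Re l > 0) \<and>
     sorted (map (\<lambda>(k, l). Im l) j0)"

text \<open>All Jordan blocks for \<open>l\<close> have size one.\<close>
definition semisimple_eigenvalue :: "complex mat \<Rightarrow> complex \<Rightarrow> bool" where
  "semisimple_eigenvalue A l \<longleftrightarrow> eigenvalue A l \<and>
     (\<forall>bs. jordan_nf A bs \<longrightarrow> (\<forall>k. (k, l) \<in> set bs \<longrightarrow> k = 1))"


subsection \<open>Infinite-horizon scaled Gramian\<close>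

definition B_tilde :: "complex mat \<Rightarrow> real vec \<Rightarrow> complex mat" where
  "B_tilde Q p = minv Q * mat_diag (dim_vec p) (\<lambda>i. complex_of_real (p $ i)) * mat_adjoint (minv Q)"

definition W_minus :: "complex mat \<Rightarrow> jblocks \<Rightarrow> jblocks \<Rightarrow> jblocks \<Rightarrow> real vec \<Rightarrow> complex mat" where
  "W_minus Q jm j0 jp p = sylvester_sol (jordan_matrix jm) (mat_adjoint (jordan_matrix jm))
     (mat_part [total_size jm, total_size j0, total_size jp] (B_tilde Q p) 0 0)"

definition W_plus :: "complex mat \<Rightarrow> jblocks \<Rightarrow> jblocks \<Rightarrow> jblocks \<Rightarrow> real vec \<Rightarrow> complex mat" where
  "W_plus Q jm j0 jp p = sylvester_sol (- jordan_matrix jp) (- mat_adjoint (jordan_matrix jp))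
     (mat_part [total_size jm, total_size j0, total_size jp] (B_tilde Q p) 2 2)"

text \<open>The lower right entry of the block \<open>(i, j)\<close> in the partition by Jordan blocks.\<close>
definition b_tilde :: "complex mat \<Rightarrow> jblocks \<Rightarrow> real vec \<Rightarrow> nat \<Rightarrow> nat \<Rightarrow> complex" where
  "b_tilde Q bs p i j =
     mat_part (map fst bs) (B_tilde Q p) i j $$ (fst (bs ! i) - 1, fst (bs ! j) - 1)"

text \<open>With row and column indices from 1 the exponents would read \<open>k - a\<close> and \<open>l - b\<close>.\<close>
definition C_coeff :: "nat \<Rightarrow> nat \<Rightarrow> real mat" where
  "C_coeff k l = mat k l (\<lambda>(a, b).
     1 / (fact (k - 1 - a) * fact (l - 1 - b) * real ((k - 1 - a) + (l - 1 - b) + 1)))"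

text \<open>Since \<open>j0\<close> is sorted by imaginary part and all real parts in it vanish, equal eigenvalues are
  adjacent and the distinct eigenvalues are listed by strictly increasing imaginary part.\<close>
definition distinct_eigenvalues :: "jblocks \<Rightarrow> complex list" where
  "distinct_eigenvalues j0 = remdups (map snd j0)"

definition num_blocks :: "jblocks \<Rightarrow> nat \<Rightarrow> nat" where
  "num_blocks j0 l = length (filter (\<lambda>(k, \<mu>). \<mu> = distinct_eigenvalues j0 ! l) j0)"

text \<open>\<open>\<alpha>\<close> is the index in \<open>bs\<close> of the first Jordan block of group \<open>l\<close>.\<close>
definition W_zero_group ::
  "complex mat \<Rightarrow> jblocks \<Rightarrow> jblocks \<Rightarrow> jblocks \<Rightarrow> real vec \<Rightarrow> nat \<Rightarrow> complex mat" where
  "W_zero_group Q jm j0 jp p l =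
     (let bs = jm @ j0 @ jp;
          \<alpha> = length jm + (\<Sum>h<l. num_blocks j0 h)
      in mat_of_blocks (map fst (take (num_blocks j0 l) (drop \<alpha> bs)))
           (\<lambda>i j. b_tilde Q bs p (\<alpha> + i) (\<alpha> + j) \<cdot>\<^sub>m
                  cmat (C_coeff (fst (bs ! (\<alpha> + i))) (fst (bs ! (\<alpha> + j))))))"

definition W_zero :: "complex mat \<Rightarrow> jblocks \<Rightarrow> jblocks \<Rightarrow> jblocks \<Rightarrow> real vec \<Rightarrow> complex mat" where
  "W_zero Q jm j0 jp p =
     diag_block_mat (map (W_zero_group Q jm j0 jp p) [0..<length (distinct_eigenvalues j0)])"

definition W_inf :: "complex mat \<Rightarrow> jblocks \<Rightarrow> jblocks \<Rightarrow> jblocks \<Rightarrow> real vec \<Rightarrow> complex mat" where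
  "W_inf Q jm j0 jp p =
     diag_block_mat [W_minus Q jm j0 jp p, W_zero Q jm j0 jp p, W_plus Q jm j0 jp p]"


subsection \<open>Real Schur construction\<close>

definition block_schur_decomposition ::
  "nat \<Rightarrow> nat \<Rightarrow> nat \<Rightarrow> nat \<Rightarrow> real mat \<Rightarrow> real mat \<Rightarrow> real mat \<Rightarrow> real mat \<Rightarrow> real mat \<Rightarrow>
   real mat \<Rightarrow> real mat \<Rightarrow> real mat \<Rightarrow> bool" where
  "block_schur_decomposition n nm n0 np A R1 Am A0m A0 Apm Ap0 Ap \<longleftrightarrow>
     R1 \<in> carrier_mat n n \<and> R1\<^sup>T * R1 = 1\<^sub>m n \<and>
     Am \<in> carrier_mat nm nm \<and> A0m \<in> carrier_mat n0 nm \<and> A0 \<in> carrier_mat n0 n0 \<and>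
     Apm \<in> carrier_mat np nm \<and> Ap0 \<in> carrier_mat np n0 \<and> Ap \<in> carrier_mat np np \<and>
     R1\<^sup>T * A * R1 = lower_block3 Am A0m A0 Apm Ap0 Ap \<and>
     (\<forall>l. eigenvalue (cmat Am) l \<longrightarrow> Re l < 0) \<and>
     (\<forall>l. eigenvalue (cmat A0) l \<longrightarrow> Re l = 0) \<and>
     (\<forall>l. eigenvalue (cmat Ap) l \<longrightarrow> Re l > 0)"

text \<open>For a vector \<open>r\<close>, this is \<open>r\<close> times its transpose.\<close>
definition outer_square :: "'a::times vec \<Rightarrow> 'a mat" where
  "outer_square r = mat (dim_vec r) (dim_vec r) (\<lambda>(a, b). r $ a * r $ b)"

definition weighted_sum :: "nat \<Rightarrow> real vec \<Rightarrow> (nat \<Rightarrow> real mat) \<Rightarrow> real mat" where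
  "weighted_sum k p V = mat k k (\<lambda>(a, b). \<Sum>i<dim_vec p. p $ i * V i $$ (a, b))"

text \<open>In the following, \<open>ns\<close> is the list of the three block sizes.\<close>
definition r_part :: "nat list \<Rightarrow> real mat \<Rightarrow> nat \<Rightarrow> nat \<Rightarrow> real vec" where
  "r_part ns R h i = vec_part ns (minv R *\<^sub>v unit_vec (dim_row R) i) h"

definition V_minus :: "nat list \<Rightarrow> real mat \<Rightarrow> real mat \<Rightarrow> real vec \<Rightarrow> real mat" where
  "V_minus ns R Am p =
     weighted_sum (ns ! 0) p (\<lambda>i. sylvester_sol Am (Am\<^sup>T) (outer_square (r_part ns R 0 i)))"

definition V_zero :: "nat list \<Rightarrow> real mat \<Rightarrow> real vec \<Rightarrow> real mat" where
  "V_zero ns R p = weighted_sum (ns ! 1) p (\<lambda>i. outer_square (r_part ns R 1 i))"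

definition V_plus :: "nat list \<Rightarrow> real mat \<Rightarrow> real mat \<Rightarrow> real vec \<Rightarrow> real mat" where
  "V_plus ns R Ap p =
     weighted_sum (ns ! 2) p (\<lambda>i. sylvester_sol (- Ap) (- Ap\<^sup>T) (outer_square (r_part ns R 2 i)))"

definition V_all :: "nat list \<Rightarrow> real mat \<Rightarrow> real mat \<Rightarrow> real mat \<Rightarrow> real vec \<Rightarrow> real mat" where
  "V_all ns R Am Ap p = diag_block_mat [V_minus ns R Am p, V_zero ns R p, V_plus ns R Ap p]"


subsection \<open>Objective functions\<close>

text \<open>The determinants and traces below are real on the feasible sets, where the matrices involved
  are Hermitian.\<close>
definition obj_logdet_W ::
  "complex mat \<Rightarrow> jblocks \<Rightarrow> jblocks \<Rightarrow> jblocks \<Rightarrow> real vec \<Rightarrow> real" where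
  "obj_logdet_W Q jm j0 jp p = - ln (Re (det (W_inf Q jm j0 jp p)))"

definition obj_logdet_V :: "nat list \<Rightarrow> real mat \<Rightarrow> real mat \<Rightarrow> real mat \<Rightarrow> real vec \<Rightarrow> real" where
  "obj_logdet_V ns R Am Ap p = - ln (det (V_all ns R Am Ap p))"

definition obj_trace_W ::
  "complex mat \<Rightarrow> jblocks \<Rightarrow> jblocks \<Rightarrow> jblocks \<Rightarrow> real vec \<Rightarrow> real" where
  "obj_trace_W Q jm j0 jp p = Re (mat_trace (mat_adjoint (minv Q) *
     diag_block_mat [minv (W_minus Q jm j0 jp p),
       0\<^sub>m (total_size j0) (total_size j0), 0\<^sub>m (total_size jp) (total_size jp)] * minv Q))"

definition obj_trace_V :: "nat list \<Rightarrow> real mat \<Rightarrow> real mat \<Rightarrow> real vec \<Rightarrow> real" where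
  "obj_trace_V ns R Am p = mat_trace (minv (V_minus ns R Am p))"

end

theory Submission
  imports Defs
begin

text \<open>Put \<open>S = Q\<^sup>-\<^sup>1 R\<close>. Then \<open>J S = S diag(A_-, A_0, A_+)\<close>, and since the spectra of the three groups
  are separated by the sign of the real part, \<open>S\<close> is block diagonal. From
  \<open>Q\<^sup>-\<^sup>1 diag(p) Q\<^sup>-\<^sup>* = S (R\<^sup>-\<^sup>1 diag(p) R\<^sup>-\<^sup>T) S\<^sup>*\<close> and the uniqueness of solutions of Lyapunov equations,
  \<open>W_-\<close> and \<open>W_+\<close> are the congruences of \<open>V_-\<close> and \<open>V_+\<close> by the blocks of \<open>S\<close>; the same holds for
  \<open>W_0\<close> and \<open>V_0\<close>, because under the hypotheses all Jordan blocks of the middle group are \<open>(0)\<close>.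
  Hence \<open>W_\<infinity> = S V S\<^sup>*\<close>: positive definiteness agrees and the log-determinants differ by a constant.
  In the trace problems even the objective functions agree, since \<open>R = R1 R2\<close> with \<open>R1\<close>
  orthogonal and the first block row of \<open>R2\<close> equal to \<open>(I, O, O)\<close>.\<close>

subsection \<open>Matrices partitioned into blocks\<close>

text \<open>The Lyapunov solutions on both sides are definite descriptions
  (\<open>sylvester_sol\<close>), so their equations are available only after existence and
  uniqueness. On the \<open>V\<close> side no solution is at hand. Uniqueness comes from the fact
  that an intertwiner of two matrices with disjoint spectra vanishes, the same fact that makes
  \<open>S\<close> block diagonal; existence then follows because an injective linear operator on a
  finite-dimensional space is onto. On the \<open>W\<close> side the congruence of \<open>V\<close>
  by a block of \<open>S\<close> is itself a solution, and uniqueness is carried over through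
  \<open>S\<close>. A second mismatch is that \<open>V_minus\<close> and \<open>V_plus\<close> are
  weighted sums of solutions, one for each rank-one right-hand side, while \<open>W_minus\<close>
  and \<open>W_plus\<close> solve one equation for a full block of \<open>B_tilde\<close>; linearity
  reconciles the two. The group with positive real parts becomes a stable one after a change of
  sign. The constant between the log-determinants is minus the logarithm of
  \<open>|det S|^2\<close>.\<close>

lemma block_offset_0 [simp]: "block_offset ns 0 = 0"
  by (simp add: block_offset_def)

lemma block_offset_Cons_Suc [simp]: "block_offset (k # ns) (Suc i) = k + block_offset ns i"
  by (simp add: block_offset_def)

lemma block_offset_add_less:
  "i < length ns \<Longrightarrow> a < ns ! i \<Longrightarrow> block_offset ns i + a < sum_list ns"
proof (induction ns arbitrary: i)
  case (Cons k ns)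
  then show ?case by (cases i) auto
qed simp

lemma block_offsetE:
  assumes "j < sum_list ns"
  obtains i a where "i < length ns" "a < ns ! i" "j = block_offset ns i + a"
proof -
  have "\<exists>i<length ns. \<exists>a<ns ! i. j = block_offset ns i + a"
    using assms
  proof (induction ns arbitrary: j)
    case (Cons k ns)
    show ?case
    proof (cases "j < k")
      case True
      then show ?thesis by (intro exI[of _ 0]) auto
    next
      case False
      then have "j - k < sum_list ns" using Cons.prems by auto
      from Cons.IH[OF this] obtain i a where "i < length ns" "a < ns ! i"
        "j - k = block_offset ns i + a" by blast
      with False show ?thesis by (intro exI[of _ "Suc i"]) auto
    qed
  qed simp
  then show ?thesis using that by blast
qed

lemma sum_lessThan_add:
  "(\<Sum>j<k + (l::nat). f j) = (\<Sum>j<k. f j) + (\<Sum>j<l. (f (k + j) :: 'a::comm_monoid_add))"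
  by (induction l) (simp_all add: add.assoc)

text \<open>This splitting is behind block multiplication. With all block lengths equal to
  \<open>l\<close> it also turns a sum over a row-wise vectorised \<open>k\<close> by
  \<open>l\<close> matrix into a double sum.\<close>

lemma sum_block_offset:
  fixes f :: "nat \<Rightarrow> 'a::comm_monoid_add"
  shows "(\<Sum>j<sum_list ns. f j) = (\<Sum>i<length ns. \<Sum>a<ns ! i. f (block_offset ns i + a))"
proof (induction ns arbitrary: f)
  case (Cons k ns)
  show ?case
    by (simp add: sum_lessThan_add sum.lessThan_Suc_shift Cons.IH add.assoc del: sum.lessThan_Suc)
qed simp

lemma mat_part_carrier [simp]: "mat_part ns M i j \<in> carrier_mat (ns ! i) (ns ! j)"
  by (simp add: mat_part_def)

lemma mat_part_dim [simp]:
  "dim_row (mat_part ns M i j) = ns ! i" "dim_col (mat_part ns M i j) = ns ! j"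
  by (simp_all add: mat_part_def)

lemma mat_part_index [simp]:
  "a < ns ! i \<Longrightarrow> b < ns ! j \<Longrightarrow>
    mat_part ns M i j $$ (a, b) = M $$ (block_offset ns i + a, block_offset ns j + b)"
  by (simp add: mat_part_def)

lemma mat_part_eqI:
  assumes "M \<in> carrier_mat (sum_list ns) (sum_list ns)" "N \<in> carrier_mat (sum_list ns) (sum_list ns)"
    and parts: "\<And>i j. i < length ns \<Longrightarrow> j < length ns \<Longrightarrow> mat_part ns M i j = mat_part ns N i j"
  shows "M = N"
proof (rule eq_matI)
  fix r c assume "r < dim_row N" "c < dim_col N"
  then have "r < sum_list ns" "c < sum_list ns" using assms by auto
  then obtain i a j b where "i < length ns" "a < ns ! i" "r = block_offset ns i + a"
    "j < length ns" "b < ns ! j" "c = block_offset ns j + b"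
    by (metis block_offsetE)
  then show "M $$ (r, c) = N $$ (r, c)"
    using parts[of i j] by (metis mat_part_index)
qed (use assms in auto)

text \<open>The entrywise form makes the sum over \<open>k\<close> a sum in the coefficient
  semiring; matrices of different sizes have no common zero.\<close>

lemma mat_part_mult_index:
  fixes M N :: "'a::semiring_0 mat"
  assumes "M \<in> carrier_mat (sum_list ns) (sum_list ns)" "N \<in> carrier_mat (sum_list ns) (sum_list ns)"
    and ij: "i < length ns" "j < length ns" and ab: "a < ns ! i" "b < ns ! j"
  shows "mat_part ns (M * N) i j $$ (a, b) =
    (\<Sum>k<length ns. (mat_part ns M i k * mat_part ns N k j) $$ (a, b))"
proof -
  have "mat_part ns (M * N) i j $$ (a, b) =
      (\<Sum>c<sum_list ns. M $$ (block_offset ns i + a, c) * N $$ (c, block_offset ns j + b))"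
    using assms block_offset_add_less[OF ij(1) ab(1)] block_offset_add_less[OF ij(2) ab(2)]
    by (simp add: scalar_prod_def atLeast0LessThan)
  also have "\<dots> = (\<Sum>k<length ns. (mat_part ns M i k * mat_part ns N k j) $$ (a, b))"
    unfolding sum_block_offset using ab
    by (intro sum.cong) (simp_all add: scalar_prod_def atLeast0LessThan)
  finally show ?thesis .
qed

lemma diag_block_mat_carrier:
  "map dim_row Ds = ns \<Longrightarrow> map dim_col Ds = ns \<Longrightarrow>
    diag_block_mat Ds \<in> carrier_mat (sum_list ns) (sum_list ns)"
  by (rule carrier_matI) (simp_all only: dim_diag_block_mat)

lemma diag_block_mat_index:
  assumes "map dim_row Ds = ns" "map dim_col Ds = ns"
    and "i < length ns" "j < length ns" "a < ns ! i" "b < ns ! j"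
  shows "diag_block_mat Ds $$ (block_offset ns i + a, block_offset ns j + b) =
    (if i = j then Ds ! i $$ (a, b) else 0)"
  using assms
proof (induction Ds arbitrary: ns i j)
  case (Cons D Ds)
  define ms where "ms = map dim_row Ds"
  have ns: "ns = dim_row D # ms" "map dim_col Ds = ms" "dim_col D = dim_row D"
    using Cons.prems unfolding ms_def by auto
  have E: "diag_block_mat Ds \<in> carrier_mat (sum_list ms) (sum_list ms)"
    by (rule diag_block_mat_carrier[OF ms_def[symmetric] ns(2)])
  have less: "block_offset ms i' + a' < sum_list ms" if "i' < length ms" "a' < ms ! i'" for i' a'
    using block_offset_add_less[OF that] .
  have eq: "diag_block_mat (D # Ds) = four_block_mat D (0\<^sub>m (dim_row D) (sum_list ms))
      (0\<^sub>m (sum_list ms) (dim_row D)) (diag_block_mat Ds)"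
    using E ns by (simp add: Let_def)
  have IH: "diag_block_mat Ds $$ (block_offset ms i + a, block_offset ms j + b) =
      (if i = j then Ds ! i $$ (a, b) else 0)"
    if "i < length ms" "j < length ms" "a < ms ! i" "b < ms ! j" for i j
    using Cons.IH[of ms i j] that ns(2) unfolding ms_def by blast
  \<comment> \<open>Four cases: the corner block \<open>D\<close>, the two zero borders, and the
    remaining blocks, where the induction hypothesis applies.\<close>
  show ?case
    using Cons.prems(3-) IH less E ns(1,3) unfolding eq
    by (cases i; cases j) auto
qed simp

lemma mat_part_diag_block_mat:
  assumes "map dim_row Ds = ns" "map dim_col Ds = ns" "i < length ns" "j < length ns"
  shows "mat_part ns (diag_block_mat Ds) i j = (if i = j then Ds ! i else 0\<^sub>m (ns ! i) (ns ! j))"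
proof (rule eq_matI)
  have "dim_row (Ds ! i) = ns ! i" "dim_col (Ds ! i) = ns ! i"
    using assms(1,2,3) by (metis nth_map length_map)+
  then show "dim_row (mat_part ns (diag_block_mat Ds) i j) =
      dim_row (if i = j then Ds ! i else 0\<^sub>m (ns ! i) (ns ! j))"
    "dim_col (mat_part ns (diag_block_mat Ds) i j) =
      dim_col (if i = j then Ds ! i else 0\<^sub>m (ns ! i) (ns ! j))"
    "\<And>a b. a < dim_row (if i = j then Ds ! i else 0\<^sub>m (ns ! i) (ns ! j)) \<Longrightarrow>
      b < dim_col (if i = j then Ds ! i else 0\<^sub>m (ns ! i) (ns ! j)) \<Longrightarrow>
      mat_part ns (diag_block_mat Ds) i j $$ (a, b) =
      (if i = j then Ds ! i else 0\<^sub>m (ns ! i) (ns ! j)) $$ (a, b)"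
    using assms(3,4) diag_block_mat_index[OF assms] by (auto split: if_splits)
qed

lemma diag_block_mat_nth_carrier:
  assumes "map dim_row Ds = ns" "map dim_col Ds = ns" "i < length ns"
  shows "Ds ! i \<in> carrier_mat (ns ! i) (ns ! i)"
  using assms by (metis carrier_matI length_map nth_map)

text \<open>In the block product only the term with \<open>k = i\<close> survives. Together with its
  mirror image this allows an identity such as \<open>J S = S D\<close> to be read block by
  block.\<close>

lemma mat_part_diag_block_mat_mult:
  fixes N :: "'a::semiring_0 mat"
  assumes D: "map dim_row Ds = ns" "map dim_col Ds = ns"
    and N: "N \<in> carrier_mat (sum_list ns) (sum_list ns)" and ij: "i < length ns" "j < length ns"
  shows "mat_part ns (diag_block_mat Ds * N) i j = Ds ! i * mat_part ns N i j"
proof (rule eq_matI)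
  note Di = diag_block_mat_nth_carrier[OF D ij(1)]
  fix a b assume "a < dim_row (Ds ! i * mat_part ns N i j)" "b < dim_col (Ds ! i * mat_part ns N i j)"
  then have ab: "a < ns ! i" "b < ns ! j" using Di by auto
  have "mat_part ns (diag_block_mat Ds * N) i j $$ (a, b) =
      (\<Sum>k<length ns. if k = i then (Ds ! i * mat_part ns N i j) $$ (a, b) else 0)"
    unfolding mat_part_mult_index[OF diag_block_mat_carrier[OF D] N ij ab]
    using ab ij mat_part_carrier[of ns N]
    by (intro sum.cong refl) (simp add: mat_part_diag_block_mat[OF D] del: index_mult_mat)
  then show "mat_part ns (diag_block_mat Ds * N) i j $$ (a, b) = (Ds ! i * mat_part ns N i j) $$ (a, b)"
    using ij by simp
qed (use diag_block_mat_nth_carrier[OF D ij(1)] in simp_all)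

lemma mat_part_mult_diag_block_mat:
  fixes N :: "'a::semiring_0 mat"
  assumes D: "map dim_row Ds = ns" "map dim_col Ds = ns"
    and N: "N \<in> carrier_mat (sum_list ns) (sum_list ns)" and ij: "i < length ns" "j < length ns"
  shows "mat_part ns (N * diag_block_mat Ds) i j = mat_part ns N i j * Ds ! j"
proof (rule eq_matI)
  note Dj = diag_block_mat_nth_carrier[OF D ij(2)]
  fix a b assume "a < dim_row (mat_part ns N i j * Ds ! j)" "b < dim_col (mat_part ns N i j * Ds ! j)"
  then have ab: "a < ns ! i" "b < ns ! j" using Dj by auto
  have "mat_part ns (N * diag_block_mat Ds) i j $$ (a, b) =
      (\<Sum>k<length ns. if k = j then (mat_part ns N i j * Ds ! j) $$ (a, b) else 0)"
    unfolding mat_part_mult_index[OF N diag_block_mat_carrier[OF D] ij ab]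
    using ab ij mat_part_carrier[of ns N]
    by (intro sum.cong refl) (simp add: mat_part_diag_block_mat[OF D] del: index_mult_mat)
  then show "mat_part ns (N * diag_block_mat Ds) i j $$ (a, b) = (mat_part ns N i j * Ds ! j) $$ (a, b)"
    using ij by simp
qed (use diag_block_mat_nth_carrier[OF D ij(2)] in simp_all)

lemma diag_block_mat_mult:
  fixes Ds Es :: "'a::semiring_0 mat list"
  assumes D: "map dim_row Ds = ns" "map dim_col Ds = ns"
    and E: "map dim_row Es = ns" "map dim_col Es = ns"
  shows "diag_block_mat Ds * diag_block_mat Es = diag_block_mat (map2 (*) Ds Es)"
proof (rule mat_part_eqI)
  have len: "length Ds = length ns" "length Es = length ns"
    using D(1) E(1) by (metis length_map)+
  have "map dim_row (map2 (*) Ds Es) = map dim_row Ds" "map dim_col (map2 (*) Ds Es) = map dim_col Es"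
    using len by (auto intro!: nth_equalityI)
  then have F: "map dim_row (map2 (*) Ds Es) = ns" "map dim_col (map2 (*) Ds Es) = ns"
    using D E by simp_all
  show "diag_block_mat (map2 (*) Ds Es) \<in> carrier_mat (sum_list ns) (sum_list ns)"
    by (rule diag_block_mat_carrier[OF F])
  show "diag_block_mat Ds * diag_block_mat Es \<in> carrier_mat (sum_list ns) (sum_list ns)"
    using diag_block_mat_carrier[OF D] diag_block_mat_carrier[OF E] by simp
  fix i j assume ij: "i < length ns" "j < length ns"
  show "mat_part ns (diag_block_mat Ds * diag_block_mat Es) i j =
      mat_part ns (diag_block_mat (map2 (*) Ds Es)) i j"
    using diag_block_mat_nth_carrier[OF D ij(1)] ij len
    by (simp add: mat_part_diag_block_mat_mult[OF D diag_block_mat_carrier[OF E] ij]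
        mat_part_diag_block_mat[OF E ij] mat_part_diag_block_mat[OF F ij])
qed

text \<open>Gives \<open>S\<close> its block-diagonal shape once its off-diagonal blocks are known
  to vanish.\<close>

lemma diag_block_mat_parts:
  assumes M: "M \<in> carrier_mat (sum_list ns) (sum_list ns)"
    and off: "\<And>i j. i < length ns \<Longrightarrow> j < length ns \<Longrightarrow> i \<noteq> j \<Longrightarrow>
      mat_part ns M i j = 0\<^sub>m (ns ! i) (ns ! j)"
  shows "diag_block_mat (map (\<lambda>i. mat_part ns M i i) [0..<length ns]) = M" (is "diag_block_mat ?Ds = M")
proof (rule mat_part_eqI[OF _ M])
  have D: "map dim_row ?Ds = ns" "map dim_col ?Ds = ns"
    by (auto intro!: nth_equalityI)
  show "diag_block_mat ?Ds \<in> carrier_mat (sum_list ns) (sum_list ns)"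
    by (rule diag_block_mat_carrier[OF D])
  fix i j assume "i < length ns" "j < length ns"
  then show "mat_part ns (diag_block_mat ?Ds) i j = mat_part ns M i j"
    using off[of i j] by (simp add: mat_part_diag_block_mat[OF D])
qed

lemma det_diag_block_mat:
  fixes Ds :: "'a::idom mat list"
  assumes "\<And>D. D \<in> set Ds \<Longrightarrow> square_mat D"
  shows "det (diag_block_mat Ds) = prod_list (map det Ds)"
  using assms
proof (induction Ds)
  case Nil
  show ?case
    unfolding diag_block_mat.simps list.map prod_list.Nil
    by (rule det_dim_zero) (rule zero_carrier_mat)
next
  case (Cons D Ds)
  define E where "E = diag_block_mat Ds"
  have "square_mat D" "square_mat E"
    using Cons.prems unfolding E_def by (auto intro!: diag_block_mat_square simp del: square_mat.simps)
  then have dims: "dim_col D = dim_row D" "dim_col E = dim_row E"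
    unfolding square_mat.simps by simp_all
  have D: "D \<in> carrier_mat (dim_row D) (dim_row D)" and E: "E \<in> carrier_mat (dim_row E) (dim_row E)"
    by (rule carrier_matI[OF refl dims(1)], rule carrier_matI[OF refl dims(2)])
  have "det (four_block_mat D (0\<^sub>m (dim_row D) (dim_row E)) (0\<^sub>m (dim_row E) (dim_row D)) E) =
      det D * det E"
    by (rule det_four_block_mat_upper_right_zero[OF D refl zero_carrier_mat E])
  moreover have "det E = prod_list (map det Ds)"
    unfolding E_def by (rule Cons.IH) (rule Cons.prems, simp)
  ultimately show ?case
    unfolding diag_block_mat.simps Let_def E_def[symmetric] list.map prod_list.Cons dims by simp
qed

lemma inverse_ofE:
  fixes M :: "'a::field mat"
  assumes M: "M \<in> carrier_mat k k" and det: "det M \<noteq> 0"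
  obtains M' where "M' \<in> carrier_mat k k" "M * M' = 1\<^sub>m k" "M' * M = 1\<^sub>m k"
proof -
  have "M \<in> Units (ring_mat TYPE('a) k ())" by (rule det_non_zero_imp_unit[OF M det])
  then have "\<exists>M' \<in> carrier_mat k k. M' * M = 1\<^sub>m k \<and> M * M' = 1\<^sub>m k"
    unfolding Units_def ring_mat_def by simp
  then show ?thesis using that by blast
qed

subsection \<open>Adjoints\<close>

lemma mat_adjoint_dim [simp]:
  "dim_row (mat_adjoint M) = dim_col M" "dim_col (mat_adjoint M) = dim_row M"
  by (simp_all add: mat_adjoint_def)

lemma mat_adjoint_carrier [simp]:
  "mat_adjoint M \<in> carrier_mat k l \<longleftrightarrow> M \<in> carrier_mat l k"
  unfolding carrier_mat_def mem_Collect_eq mat_adjoint_dim by blast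

lemma mat_adjoint_index [simp]:
  "i < dim_col M \<Longrightarrow> j < dim_row M \<Longrightarrow> mat_adjoint M $$ (i, j) = conjugate (M $$ (j, i))"
  by (simp add: mat_adjoint_def mat_of_rows_def)

lemma mat_adjoint_adjoint [simp]: "mat_adjoint (mat_adjoint M) = M"
  by (rule eq_matI) auto

lemma mat_adjoint_one [simp]:
  "mat_adjoint (1\<^sub>m k) = (1\<^sub>m k :: complex mat)"
  by (rule eq_matI) auto

lemma mat_adjoint_mult:
  fixes M N :: "'a::conjugatable_field mat"
  assumes "M \<in> carrier_mat k l" "N \<in> carrier_mat l m"
  shows "mat_adjoint (M * N) = mat_adjoint N * mat_adjoint M"
proof (rule eq_matI)
  fix i j assume "i < dim_row (mat_adjoint N * mat_adjoint M)" "j < dim_col (mat_adjoint N * mat_adjoint M)"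
  then show "mat_adjoint (M * N) $$ (i, j) = (mat_adjoint N * mat_adjoint M) $$ (i, j)"
    using assms by (simp add: scalar_prod_def sum_conjugate conjugate_dist_mul mult.commute)
qed (use assms in auto)

lemma mat_adjoint_diag_block_mat:
  fixes Ds :: "'a::conjugatable_field mat list"
  shows "mat_adjoint (diag_block_mat Ds) = diag_block_mat (map mat_adjoint Ds)"
proof (induction Ds)
  case (Cons D Ds)
  then show ?case
    by (intro eq_matI) (auto simp: Let_def simp flip: Cons.IH)
qed (auto intro!: eq_matI)

lemma map_mat_diag_block_mat:
  "f 0 = 0 \<Longrightarrow> map_mat f (diag_block_mat Ds) = diag_block_mat (map (map_mat f) Ds)"
proof (induction Ds)
  case (Cons D Ds)
  then show ?case
    by (intro eq_matI) (auto simp: Let_def simp flip: Cons.IH(1))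
qed (auto intro!: eq_matI)

lemma mat_adjoint_cmat: "mat_adjoint (cmat M) = cmat (M\<^sup>T)"
  by (rule eq_matI) auto

subsection \<open>Sylvester equations\<close>

text \<open>The list \<open>es\<close> of roots is also the diagonal of the triangular factor in the
  Schur decomposition, so every diagonal entry met there is an eigenvalue of
  \<open>B\<close>.\<close>

lemma eigenvalue_in_schur_diagonal:
  assumes "B \<in> carrier_mat l l" "char_poly B = (\<Prod>e\<leftarrow>es. [:- e, 1:])" "e \<in> set es"
  shows "eigenvalue (B :: 'a::field mat) e"
  using assms(3) unfolding eigenvalue_root_char_poly[OF assms(1)] assms(2)
  by (induction es) auto

text \<open>With \<open>B\<close> triangularised, the first non-zero column of \<open>X\<close> would be an eigenvector of \<open>A\<close>
  for an eigenvalue of \<open>B\<close>.\<close>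
lemma intertwiner_eq_0:
  fixes A B X :: "complex mat"
  assumes A: "A \<in> carrier_mat k k" and B: "B \<in> carrier_mat l l" and X: "X \<in> carrier_mat k l"
    and eq: "A * X = X * B"
    and disj: "\<And>z. eigenvalue A z \<Longrightarrow> eigenvalue B z \<Longrightarrow> False"
  shows "X = 0\<^sub>m k l"
proof -
  obtain es where es: "char_poly B = (\<Prod>e\<leftarrow>es. [:- e, 1:])" "length es = l"
    using char_poly_factorized[OF B] by auto
  obtain T P P' where "schur_decomposition B es = (T, P, P')" by (metis prod_cases3)
  from schur_decomposition[OF B es(1) this]
  have wit: "similar_mat_wit B T P P'" and T: "upper_triangular T" "diag_mat T = es" by auto
  note wit = similar_mat_witD2[OF B wit]
  define Y where "Y = X * P"
  have Y: "Y \<in> carrier_mat k l" unfolding Y_def using X wit by auto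
  have "A * Y = (A * X) * P" unfolding Y_def using A X wit by (simp add: assoc_mult_mat[of _ k k _ l])
  also have "\<dots> = X * (P * T * P') * P" using eq wit by simp
  also have "\<dots> = Y * T * (P' * P)" unfolding Y_def using X wit
    by (simp add: assoc_mult_mat[of _ k l _ l _ l] assoc_mult_mat[of _ l l _ l _ l])
  also have "\<dots> = Y * T" using Y wit by (simp add: right_mult_one_mat[of _ k l])
  finally have AY: "A * Y = Y * T" .
  \<comment> \<open>Strong induction on the column: the columns of \<open>Y\<close> before
    \<open>j\<close> vanish, and \<open>T\<close> has no entries below the diagonal, so column
    \<open>j\<close> of \<open>Y * T\<close> is just \<open>T $$ (j, j)\<close> times column
    \<open>j\<close> of \<open>Y\<close>. If that column were non-zero, the two spectra would
    meet.\<close>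
  have cols: "j < l \<Longrightarrow> col Y j = 0\<^sub>v k" for j
  proof (induction j rule: less_induct)
    case (less j)
    have Tj: "T $$ (j, j) \<in> set es" using T(2) wit less.prems by (auto simp: diag_mat_def)
    have "A *\<^sub>v col Y j = T $$ (j, j) \<cdot>\<^sub>v col Y j"
    proof (rule eq_vecI)
      fix i assume "i < dim_vec (T $$ (j, j) \<cdot>\<^sub>v col Y j)"
      then have i: "i < k" using Y by auto
      have "(A *\<^sub>v col Y j) $ i = (A * Y) $$ (i, j)" using A Y i less.prems by simp
      also have "\<dots> = (\<Sum>c<l. Y $$ (i, c) * T $$ (c, j))"
        unfolding AY using Y wit i less.prems by (simp add: scalar_prod_def atLeast0LessThan)
      also have "\<dots> = (\<Sum>c<l. if c = j then Y $$ (i, j) * T $$ (j, j) else 0)"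
      proof (rule sum.cong)
        fix c assume c: "c \<in> {..<l}"
        consider "c < j" | "c = j" | "j < c" by linarith
        then show "Y $$ (i, c) * T $$ (c, j) = (if c = j then Y $$ (i, j) * T $$ (j, j) else 0)"
        proof cases
          case 1
          with less.IH[of c] less.prems have "col Y c $ i = 0" using i by simp
          with 1 c i Y show ?thesis by simp
        next
          case 3
          then show ?thesis using upper_triangularD[OF T(1) 3] wit c by auto
        qed simp
      qed simp
      finally show "(A *\<^sub>v col Y j) $ i = (T $$ (j, j) \<cdot>\<^sub>v col Y j) $ i"
        using less.prems Y i by (simp add: mult.commute)
    qed (use A Y in auto)
    then have "eigenvalue A (T $$ (j, j))" if "col Y j \<noteq> 0\<^sub>v k"
      unfolding eigenvalue_def eigenvector_def using that A Y less.prems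
      by (intro exI[of _ "col Y j"]) auto
    then show ?case using disj eigenvalue_in_schur_diagonal[OF B es(1) Tj] by blast
  qed
  have "Y = 0\<^sub>m k l"
  proof (rule eq_matI)
    fix i j assume "i < dim_row (0\<^sub>m k l :: complex mat)" "j < dim_col (0\<^sub>m k l :: complex mat)"
    then show "Y $$ (i, j) = 0\<^sub>m k l $$ (i, j)" using cols[of j] Y
      by (metis index_col index_zero_mat carrier_matD index_zero_vec(1))
  qed (use Y in auto)
  moreover have "X = Y * P'" unfolding Y_def using X wit by (simp add: assoc_mult_mat[of _ k l _ l])
  ultimately show ?thesis using wit by simp
qed

lemma block_offset_replicate: "i \<le> k \<Longrightarrow> block_offset (replicate k l) i = i * l"
  by (simp add: block_offset_def sum_list_replicate min_def)

text \<open>The left-hand side is the matrix of the operator \<open>X \<mapsto> A X + X B\<close> on row-wise vectorised matrices.\<close>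
lemma sylvester_operator_index:
  fixes A B :: "'a::field mat"
  assumes A: "A \<in> carrier_mat k k" and B: "B \<in> carrier_mat l l" and v: "v \<in> carrier_vec (k * l)"
    and a: "a < k" and b: "b < l"
  defines "X \<equiv> mat k l (\<lambda>(a, b). v $ (a * l + b))"
  shows "(mat (k * l) (k * l) (\<lambda>(i, j). (if i mod l = j mod l then A $$ (i div l, j div l) else 0) +
      (if i div l = j div l then B $$ (j mod l, i mod l) else 0)) *\<^sub>v v) $ (a * l + b) =
    (A * X + X * B) $$ (a, b)"
    (is "(mat _ _ ?f *\<^sub>v v) $ _ = _")
proof -
  have ab: "a * l + b < k * l"
    using block_offset_add_less[of a "replicate k l" b] a b
    by (simp add: block_offset_replicate sum_list_replicate)
  have "(mat (k * l) (k * l) ?f *\<^sub>v v) $ (a * l + b) = (\<Sum>j<k * l. ?f (a * l + b, j) * v $ j)"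
    using ab v by (simp add: scalar_prod_def atLeast0LessThan)
  \<comment> \<open>The index range is viewed as \<open>k\<close> consecutive blocks of length
    \<open>l\<close>, so that \<open>sum_block_offset\<close> replaces \<open>j\<close> by
    \<open>c * l + d\<close>.\<close>
  also have "\<dots> = (\<Sum>j<sum_list (replicate k l). ?f (a * l + b, j) * v $ j)"
    by (simp add: sum_list_replicate)
  also have "\<dots> = (\<Sum>c<k. \<Sum>d<l. ?f (a * l + b, c * l + d) * v $ (c * l + d))"
    unfolding sum_block_offset by (simp add: block_offset_replicate)
  \<comment> \<open>In the row belonging to \<open>(a, b)\<close>, the \<open>A\<close> part can be
    non-zero only for \<open>d = b\<close> and the \<open>B\<close> part only for
    \<open>c = a\<close>.\<close>
  also have "\<dots> = (\<Sum>c<k. \<Sum>d<l. (if d = b then A $$ (a, c) * v $ (c * l + b) else 0) +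
      (if c = a then B $$ (d, b) * v $ (a * l + d) else 0))"
    using b by (intro sum.cong refl) (auto simp: algebra_simps)
  also have "\<dots> = (\<Sum>c<k. A $$ (a, c) * v $ (c * l + b) +
      (if c = a then \<Sum>d<l. B $$ (d, b) * v $ (a * l + d) else 0))"
    using b by (intro sum.cong refl) (simp add: sum.distrib)
  also have "\<dots> = (\<Sum>c<k. A $$ (a, c) * v $ (c * l + b)) + (\<Sum>d<l. v $ (a * l + d) * B $$ (d, b))"
    using a by (simp add: sum.distrib mult.commute)
  also have "\<dots> = (A * X + X * B) $$ (a, b)"
    using A B a b unfolding X_def by (simp add: scalar_prod_def atLeast0LessThan)
  finally show ?thesis .
qed

text \<open>An injective linear operator on the space of \<open>k\<close> by \<open>l\<close>
  matrices is onto. In vectorised form, a kernel vector of the operator matrix \<open>M\<close>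
  would be a non-zero solution of the homogeneous equation, so \<open>det M\<close> is non-zero and
  \<open>M\<close> can be inverted.\<close>

lemma sylvester_ex:
  fixes A B :: "'a::field mat"
  assumes A: "A \<in> carrier_mat k k" and B: "B \<in> carrier_mat l l" and C: "C \<in> carrier_mat k l"
    and inj: "\<forall>X \<in> carrier_mat k l. A * X + X * B = 0\<^sub>m k l \<longrightarrow> X = 0\<^sub>m k l"
  shows "\<exists>X \<in> carrier_mat k l. A * X + X * B + C = 0\<^sub>m k l"
proof -
  let ?N = "k * l"
  define M where "M = mat ?N ?N (\<lambda>(i, j). (if i mod l = j mod l then A $$ (i div l, j div l) else 0) +
      (if i div l = j div l then B $$ (j mod l, i mod l) else 0))"
  define unvec where "unvec v = mat k l (\<lambda>(a, b). v $ (a * l + b))" for v :: "'a vec"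
  have M: "M \<in> carrier_mat ?N ?N" by (simp add: M_def)
  have unvec: "unvec v \<in> carrier_mat k l" for v by (simp add: unvec_def)
  have Mv: "(M *\<^sub>v v) $ (a * l + b) = (A * unvec v + unvec v * B) $$ (a, b)"
    if "v \<in> carrier_vec ?N" "a < k" "b < l" for v a b
    unfolding M_def unvec_def by (rule sylvester_operator_index[OF A B that])
  have index: "\<exists>a<k. \<exists>b<l. i = a * l + b" if "i < ?N" for i
  proof -
    \<comment> \<open>Splitting an index by \<open>div\<close> and \<open>mod\<close> requires
      \<open>l > 0\<close>; for \<open>l = 0\<close> there is no index below
      \<open>k * l\<close>.\<close>
    have "l \<noteq> 0" using that by (rule contrapos_pn) simp
    then have "i div l < k" "i mod l < l"
      using that by (simp_all only: less_mult_imp_div_less mod_less_divisor neq0_conv)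
    then show ?thesis using div_mult_mod_eq[of i l] by metis
  qed
  have ab: "a * l + b < ?N" if "a < k" "b < l" for a b
    using block_offset_add_less[of a "replicate k l" b] that
    by (simp add: block_offset_replicate sum_list_replicate)
  have det: "det M \<noteq> 0"
  proof
    assume "det M = 0"
    then obtain v where v: "v \<in> carrier_vec ?N" "v \<noteq> 0\<^sub>v ?N" "M *\<^sub>v v = 0\<^sub>v ?N"
      using det_0_iff_vec_prod_zero_field[OF M] by blast
    have "A * unvec v + unvec v * B = 0\<^sub>m k l"
    proof (rule eq_matI)
      fix a b assume "a < dim_row (0\<^sub>m k l :: 'a mat)" "b < dim_col (0\<^sub>m k l :: 'a mat)"
      then have "a < k" "b < l" by auto
      then show "(A * unvec v + unvec v * B) $$ (a, b) = 0\<^sub>m k l $$ (a, b)"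
        using Mv[OF v(1), of a b] ab[of a b] v(3) by simp
    qed (use A B unvec[of v] in auto)
    then have "unvec v = 0\<^sub>m k l" using inj unvec by blast
    then have "unvec v $$ (a, b) = 0" if "a < k" "b < l" for a b
      using that by simp
    then have "v $ (a * l + b) = 0" if "a < k" "b < l" for a b
      using that by (simp add: unvec_def)
    then have "v $ i = 0" if "i < ?N" for i using index[OF that] by blast
    then have "v = 0\<^sub>v ?N" using v(1) by (intro eq_vecI) auto
    with v(2) show False by simp
  qed
  obtain M' where M': "M' \<in> carrier_mat ?N ?N" "M * M' = 1\<^sub>m ?N"
    using inverse_ofE[OF M det] by blast
  \<comment> \<open>The row-wise vectorisation of \<open>- C\<close>; the solution is the matrix
    form of \<open>M' *\<^sub>v w\<close>.\<close>
  define w where "w = vec ?N (\<lambda>i. - C $$ (i div l, i mod l))"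
  define v where "v = M' *\<^sub>v w"
  have w: "w \<in> carrier_vec ?N" by (simp add: w_def)
  have v: "v \<in> carrier_vec ?N" unfolding v_def by (rule mult_mat_vec_carrier[OF M'(1) w])
  have "M *\<^sub>v v = (M * M') *\<^sub>v w"
    unfolding v_def by (rule assoc_mult_mat_vec[symmetric, OF M M'(1) w])
  then have MV: "M *\<^sub>v v = w" using w M'(2) by simp
  have "A * unvec v + unvec v * B + C = 0\<^sub>m k l"
  proof (rule eq_matI)
    fix a b assume "a < dim_row (0\<^sub>m k l :: 'a mat)" "b < dim_col (0\<^sub>m k l :: 'a mat)"
    then have lt: "a < k" "b < l" by auto
    have "(A * unvec v + unvec v * B) $$ (a, b) = w $ (a * l + b)"
      using Mv[OF v lt] unfolding MV by (rule sym)
    also have "\<dots> = - C $$ (a, b)" using ab[OF lt] lt by (simp add: w_def)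
    finally show "(A * unvec v + unvec v * B + C) $$ (a, b) = 0\<^sub>m k l $$ (a, b)"
      using lt C by (simp del: index_mult_mat(1))
  qed (use C in auto)
  then show ?thesis using unvec by blast
qed

text \<open>The difference of two solutions solves the homogeneous equation. Hence exhibiting any
  one solution determines the definite description.\<close>

lemma sylvester_sol_eqI:
  fixes A B :: "'a::field mat"
  assumes A: "A \<in> carrier_mat k k" and B: "B \<in> carrier_mat l l" and C: "C \<in> carrier_mat k l"
    and inj: "\<forall>X \<in> carrier_mat k l. A * X + X * B = 0\<^sub>m k l \<longrightarrow> X = 0\<^sub>m k l"
    and X: "X \<in> carrier_mat k l" "A * X + X * B + C = 0\<^sub>m k l"
  shows "sylvester_sol A B C = X"
proof -
  have unique: "Y = X" if Y: "Y \<in> carrier_mat k l" "A * Y + Y * B + C = 0\<^sub>m k l" for Y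
  proof -
    have "A * (Y - X) + (Y - X) * B = 0\<^sub>m k l"
    proof (rule eq_matI)
      fix a b assume "a < dim_row (0\<^sub>m k l :: 'a mat)" "b < dim_col (0\<^sub>m k l :: 'a mat)"
      then have ab: "a < k" "b < l" by auto
      have "(A * (Y - X) + (Y - X) * B) $$ (a, b) =
          (A * Y - A * X) $$ (a, b) + (Y * B - X * B) $$ (a, b)"
        using ab A B X(1) Y(1) by (simp add: mult_minus_distrib_mat[OF A] minus_mult_distrib_mat[OF Y(1) X(1) B]
            del: index_mult_mat(1))
      also have "\<dots> = (A * Y + Y * B + C) $$ (a, b) - (A * X + X * B + C) $$ (a, b)"
        using ab A B C X(1) Y(1) by (simp del: index_mult_mat(1))
      also have "\<dots> = 0" using ab unfolding X(2) Y(2) by simp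
      finally show "(A * (Y - X) + (Y - X) * B) $$ (a, b) = 0\<^sub>m k l $$ (a, b)" using ab by simp
    qed (use A B X(1) Y(1) in auto)
    then have "Y - X = 0\<^sub>m k l" using inj minus_carrier_mat[OF X(1)] by blast
    then have diff: "(Y - X) $$ (a, b) = 0" if "a < k" "b < l" for a b using that by simp
    have "Y $$ (a, b) = X $$ (a, b)" if "a < k" "b < l" for a b
      using diff[OF that] that X(1) by simp
    then show "Y = X" using X(1) Y(1) by (intro eq_matI) auto
  qed
  show ?thesis
    unfolding sylvester_sol_def carrier_matD(1)[OF A] carrier_matD(2)[OF B]
    by (rule the_equality) (use X unique in blast)+
qed

lemma sylvester_sol:
  fixes A B :: "'a::field mat"
  assumes A: "A \<in> carrier_mat k k" and B: "B \<in> carrier_mat l l" and C: "C \<in> carrier_mat k l"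
    and inj: "\<forall>X \<in> carrier_mat k l. A * X + X * B = 0\<^sub>m k l \<longrightarrow> X = 0\<^sub>m k l"
  shows "sylvester_sol A B C \<in> carrier_mat k l" (is ?carrier)
    and "A * sylvester_sol A B C + sylvester_sol A B C * B + C = 0\<^sub>m k l" (is ?eq)
proof -
  obtain X where "X \<in> carrier_mat k l" "A * X + X * B + C = 0\<^sub>m k l"
    using sylvester_ex[OF A B C inj] by blast
  with sylvester_sol_eqI[OF A B C inj this] show ?carrier ?eq by simp_all
qed

section \<open>Weighted sums of matrices and linearity of Sylvester equations\<close>

lemma weighted_sum_index [simp]:
  "a < k \<Longrightarrow> b < k \<Longrightarrow> weighted_sum k p V $$ (a, b) = (\<Sum>i<dim_vec p. p $ i * V i $$ (a, b))"
  by (simp add: weighted_sum_def)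

lemma weighted_sum_carrier [simp]: "weighted_sum k p V \<in> carrier_mat k k"
  by (simp add: weighted_sum_def)

lemma weighted_sum_dim [simp]: "dim_row (weighted_sum k p V) = k" "dim_col (weighted_sum k p V) = k"
  by (simp_all add: weighted_sum_def)

lemma weighted_sum_mult:
  assumes V: "\<forall>i<dim_vec p. V i \<in> carrier_mat k k" and A: "A \<in> carrier_mat k k"
  shows "A * weighted_sum k p V = weighted_sum k p (\<lambda>i. A * V i)"
    and "weighted_sum k p V * A = weighted_sum k p (\<lambda>i. V i * A)"
proof -
  have *: "dim_row (V i) = k" "dim_col (V i) = k" if "i < dim_vec p" for i
    using V that by auto
  show "A * weighted_sum k p V = weighted_sum k p (\<lambda>i. A * V i)"
  proof (rule eq_matI)
    fix a b assume "a < dim_row (weighted_sum k p (\<lambda>i. A * V i))" "b < dim_col (weighted_sum k p (\<lambda>i. A * V i))"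
    then have ab: "a < k" "b < k" by auto
    have "(A * weighted_sum k p V) $$ (a, b) =
        (\<Sum>c<k. \<Sum>i<dim_vec p. A $$ (a, c) * (p $ i * V i $$ (c, b)))"
      using A ab by (simp add: scalar_prod_def atLeast0LessThan sum_distrib_left)
    also have "\<dots> = (\<Sum>i<dim_vec p. \<Sum>c<k. p $ i * (A $$ (a, c) * V i $$ (c, b)))"
      by (subst sum.swap) (simp only: mult.left_commute)
    also have "\<dots> = weighted_sum k p (\<lambda>i. A * V i) $$ (a, b)"
      using A ab *
      by (simp add: scalar_prod_def atLeast0LessThan sum_distrib_left)
    finally show "(A * weighted_sum k p V) $$ (a, b) = weighted_sum k p (\<lambda>i. A * V i) $$ (a, b)" .
  qed (use A in auto)
  show "weighted_sum k p V * A = weighted_sum k p (\<lambda>i. V i * A)"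
  proof (rule eq_matI)
    fix a b assume "a < dim_row (weighted_sum k p (\<lambda>i. V i * A))" "b < dim_col (weighted_sum k p (\<lambda>i. V i * A))"
    then have ab: "a < k" "b < k" by auto
    have "(weighted_sum k p V * A) $$ (a, b) =
        (\<Sum>c<k. \<Sum>i<dim_vec p. (p $ i * V i $$ (a, c)) * A $$ (c, b))"
      using A ab by (simp add: scalar_prod_def atLeast0LessThan sum_distrib_right)
    also have "\<dots> = (\<Sum>i<dim_vec p. \<Sum>c<k. p $ i * (V i $$ (a, c) * A $$ (c, b)))"
      by (subst sum.swap) (simp only: mult.assoc)
    also have "\<dots> = weighted_sum k p (\<lambda>i. V i * A) $$ (a, b)"
      using A ab *
      by (simp add: scalar_prod_def atLeast0LessThan sum_distrib_left)
    finally show "(weighted_sum k p V * A) $$ (a, b) = weighted_sum k p (\<lambda>i. V i * A) $$ (a, b)" .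
  qed (use A in auto)
qed

text \<open>By linearity, the weighted sum of the solutions for the single right-hand sides solves
  the equation for the weighted right-hand side. This connects \<open>V_minus\<close> and
  \<open>V_plus\<close>, built from rank-one terms, with the single equation behind
  \<open>W_minus\<close> and \<open>W_plus\<close>.\<close>

lemma weighted_sum_sylvester:
  assumes A: "A \<in> carrier_mat k k" and B: "B \<in> carrier_mat k k"
    and C: "\<forall>i<dim_vec p. C i \<in> carrier_mat k k"
    and V: "\<forall>i<dim_vec p. V i \<in> carrier_mat k k"
    and eq: "\<forall>i<dim_vec p. A * V i + V i * B + C i = 0\<^sub>m k k"
  shows "A * weighted_sum k p V + weighted_sum k p V * B + weighted_sum k p C = 0\<^sub>m k k"
proof (rule eq_matI)
  fix a b assume "a < dim_row (0\<^sub>m k k :: real mat)" "b < dim_col (0\<^sub>m k k :: real mat)"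
  then have ab: "a < k" "b < k" by auto
  have *: "(A * V i) $$ (a, b) + (V i * B) $$ (a, b) + C i $$ (a, b) = 0" if i: "i < dim_vec p" for i
  proof -
    have "(A * V i + V i * B + C i) $$ (a, b) = 0" using eq i ab by simp
    moreover have "C i \<in> carrier_mat k k" "V i \<in> carrier_mat k k" using C V i by auto
    ultimately show ?thesis using A B ab by (simp del: index_mult_mat(1))
  qed
  have "(A * weighted_sum k p V + weighted_sum k p V * B + weighted_sum k p C) $$ (a, b) =
      (\<Sum>i<dim_vec p. p $ i * ((A * V i) $$ (a, b) + (V i * B) $$ (a, b) + C i $$ (a, b)))"
    unfolding weighted_sum_mult[OF V A] weighted_sum_mult[OF V B]
    using ab by (simp add: sum.distrib distrib_left del: index_mult_mat(1))
  also have "\<dots> = 0" by (intro sum.neutral) (simp add: * del: index_mult_mat(1))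
  finally show "(A * weighted_sum k p V + weighted_sum k p V * B + weighted_sum k p C) $$ (a, b) =
      0\<^sub>m k k $$ (a, b)" using ab by simp
qed auto

subsection \<open>Inverses and positive definite matrices\<close>

text \<open>A right inverse of a square matrix is two-sided, so \<open>M\<close> is a unit and
  \<open>mat_inverse\<close> returns some \<open>B\<close>. Associativity then forces
  \<open>B\<close> to agree with \<open>N\<close>.\<close>

lemma minv_eqI:
  fixes M :: "'a::field mat"
  assumes M: "M \<in> carrier_mat k k" and N: "N \<in> carrier_mat k k" and MN: "M * N = 1\<^sub>m k"
  shows "minv M = N"
proof -
  have NM: "N * M = 1\<^sub>m k" by (rule mat_mult_left_right_inverse[OF M N MN])
  have "M \<in> Units (ring_mat TYPE('a) k ())"
    unfolding Units_def ring_mat_def using M N MN NM by auto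
  then obtain B where some: "mat_inverse M = Some B"
    using mat_inverse(1)[OF M, where b = "()"] by (cases "mat_inverse M") auto
  from mat_inverse(2)[OF M some] have B: "M * B = 1\<^sub>m k" "B \<in> carrier_mat k k" by auto
  have "B = (N * M) * B" using B NM by simp
  also have "\<dots> = N * (M * B)" by (rule assoc_mult_mat[OF N M B(2)])
  also have "\<dots> = N" using B N by simp
  finally show ?thesis by (simp add: minv_def some)
qed

lemma minv_inverse:
  fixes M :: "'a::field mat"
  assumes M: "M \<in> carrier_mat k k" and det: "det M \<noteq> 0"
  shows "minv M \<in> carrier_mat k k" "M * minv M = 1\<^sub>m k" "minv M * M = 1\<^sub>m k"
proof -
  obtain N where N: "N \<in> carrier_mat k k" "M * N = 1\<^sub>m k" "N * M = 1\<^sub>m k"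
    using inverse_ofE[OF M det] by blast
  with minv_eqI[OF M N(1,2)]
  show "minv M \<in> carrier_mat k k" "M * minv M = 1\<^sub>m k" "minv M * M = 1\<^sub>m k" by simp_all
qed

lemma det_nonzero_if_inverse:
  fixes M :: "'a::field mat"
  assumes M: "M \<in> carrier_mat k k" and N: "N \<in> carrier_mat k k" and MN: "M * N = 1\<^sub>m k"
  shows "det M \<noteq> 0"
proof -
  have "det M * det N = 1" using det_mult[OF M N] unfolding MN by simp
  then show ?thesis by (metis mult_zero_left zero_neq_one)
qed

lemma cmat_mult:
  "M \<in> carrier_mat k l \<Longrightarrow> N \<in> carrier_mat l m \<Longrightarrow> cmat (M * N) = cmat M * cmat N"
  by (rule of_real_hom.mat_hom_mult)

lemma cmat_add:
  "M \<in> carrier_mat k l \<Longrightarrow> N \<in> carrier_mat k l \<Longrightarrow> cmat (M + N) = cmat M + cmat N"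
  by (intro eq_matI) auto

lemma cmat_zero [simp]: "cmat (0\<^sub>m k l) = 0\<^sub>m k l"
  by (intro eq_matI) auto

lemma cmat_eq_iff: "cmat M = cmat N \<longleftrightarrow> M = N"
  using of_real_hom.mat_hom_inj by blast

lemma inner_mult_mat_vec:
  fixes S :: "complex mat"
  assumes S: "S \<in> carrier_mat k l" and w: "w \<in> carrier_vec l" and v: "v \<in> carrier_vec k"
  shows "(S *\<^sub>v w) \<bullet>c v = w \<bullet>c (mat_adjoint S *\<^sub>v v)"
proof -
  have "(S *\<^sub>v w) \<bullet>c v = (\<Sum>i<k. \<Sum>j<l. S $$ (i, j) * w $ j * cnj (v $ i))"
    using S w v by (simp add: scalar_prod_def atLeast0LessThan sum_distrib_right)
  also have "\<dots> = (\<Sum>j<l. \<Sum>i<k. w $ j * (S $$ (i, j) * cnj (v $ i)))"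
    by (subst sum.swap) (simp add: ac_simps)
  also have "\<dots> = w \<bullet>c (mat_adjoint S *\<^sub>v v)"
    using S w v by (simp add: scalar_prod_def atLeast0LessThan sum_distrib_left)
  finally show ?thesis .
qed

text \<open>The quadratic form of the congruence at \<open>v\<close> is that of \<open>X\<close> at
  \<open>u = mat_adjoint S *\<^sub>v v\<close>, and invertibility of \<open>S\<close> keeps
  \<open>u\<close> non-zero.\<close>

lemma pos_def_congruence_imp:
  assumes X: "X \<in> carrier_mat k k" and S: "S \<in> carrier_mat k k" and S': "S' \<in> carrier_mat k k"
    and inv: "S * S' = 1\<^sub>m k" and pd: "pos_def X"
  shows "pos_def (S * X * mat_adjoint S)"
proof -
  have sa: "mat_adjoint X = X"
    and pos: "\<And>v. v \<in> carrier_vec k \<Longrightarrow> v \<noteq> 0\<^sub>v k \<Longrightarrow> Re ((X *\<^sub>v v) \<bullet>c v) > 0"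
    using pd X unfolding pos_def_def by auto
  note aS = iffD2[OF mat_adjoint_carrier S] iffD2[OF mat_adjoint_carrier S']
  have SX: "S * X \<in> carrier_mat k k" using S X by simp
  have "mat_adjoint (S * X * mat_adjoint S) = S * (mat_adjoint X * mat_adjoint S)"
    by (simp add: mat_adjoint_mult[OF SX aS(1)] mat_adjoint_mult[OF S X])
  also have "\<dots> = S * X * mat_adjoint S"
    unfolding sa by (rule assoc_mult_mat[symmetric, OF S X aS(1)])
  finally have adj: "mat_adjoint (S * X * mat_adjoint S) = S * X * mat_adjoint S" .
  have "Re ((S * X * mat_adjoint S *\<^sub>v v) \<bullet>c v) > 0"
    if v: "v \<in> carrier_vec k" "v \<noteq> 0\<^sub>v k" for v
  proof -
    define u where "u = mat_adjoint S *\<^sub>v v"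
    have u: "u \<in> carrier_vec k" unfolding u_def by (rule mult_mat_vec_carrier[OF aS(1) v(1)])
    have "mat_adjoint S' * mat_adjoint S = 1\<^sub>m k"
      using mat_adjoint_mult[OF S S'] unfolding inv by simp
    then have "v = mat_adjoint S' *\<^sub>v u"
      unfolding u_def using assoc_mult_mat_vec[OF aS(2,1) v(1)] v(1) by simp
    moreover have "mat_adjoint S' *\<^sub>v 0\<^sub>v k = 0\<^sub>v k"
      using aS(2) by (intro eq_vecI) auto
    ultimately have "u \<noteq> 0\<^sub>v k" using v(2) by metis
    then have "Re ((X *\<^sub>v u) \<bullet>c u) > 0" by (rule pos[OF u])
    moreover have "S * X * mat_adjoint S *\<^sub>v v = S *\<^sub>v (X *\<^sub>v u)"
      unfolding u_def using assoc_mult_mat_vec[OF SX aS(1) v(1)]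
        assoc_mult_mat_vec[OF S X mult_mat_vec_carrier[OF aS(1) v(1)]] by simp
    moreover have "(S *\<^sub>v (X *\<^sub>v u)) \<bullet>c v = (X *\<^sub>v u) \<bullet>c u"
      unfolding u_def[symmetric] inner_mult_mat_vec[OF S mult_mat_vec_carrier[OF X u] v(1)] ..
    ultimately show ?thesis by simp
  qed
  then show ?thesis unfolding pos_def_def using adj S by auto
qed

lemma congruence_inverse:
  fixes X S S' :: "complex mat"
  assumes X: "X \<in> carrier_mat k k" and S: "S \<in> carrier_mat k k" and S': "S' \<in> carrier_mat k k"
    and inv: "S' * S = 1\<^sub>m k"
  shows "S' * (S * X * mat_adjoint S) * mat_adjoint S' = X"
proof -
  note aS = iffD2[OF mat_adjoint_carrier S] iffD2[OF mat_adjoint_carrier S']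
  have adj: "mat_adjoint S * mat_adjoint S' = 1\<^sub>m k"
    using mat_adjoint_mult[OF S' S] unfolding inv by simp
  have "S' * (S * X * mat_adjoint S) * mat_adjoint S' =
      (S' * S) * X * (mat_adjoint S * mat_adjoint S')"
    using X S S' aS by (simp add: assoc_mult_mat[of _ k k _ k _ k])
  then show ?thesis unfolding inv adj using X by simp
qed

lemma pos_def_congruence:
  assumes X: "X \<in> carrier_mat k k" and S: "S \<in> carrier_mat k k" and S': "S' \<in> carrier_mat k k"
    and inv: "S * S' = 1\<^sub>m k"
  shows "pos_def (S * X * mat_adjoint S) \<longleftrightarrow> pos_def X"
proof
  have inv': "S' * S = 1\<^sub>m k" by (rule mat_mult_left_right_inverse[OF S S' inv])
  assume "pos_def (S * X * mat_adjoint S)"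
  then have "pos_def (S' * (S * X * mat_adjoint S) * mat_adjoint S')"
    using pos_def_congruence_imp[OF _ S' S inv', of "S * X * mat_adjoint S"] X S by simp
  then show "pos_def X" unfolding congruence_inverse[OF X S S' inv'] .
qed (rule pos_def_congruence_imp[OF X S S' inv])

lemma pos_def_det_nonzero:
  assumes X: "X \<in> carrier_mat k k" and pd: "pos_def X"
  shows "det X \<noteq> 0"
proof
  assume "det X = 0"
  then obtain v where v: "v \<in> carrier_vec k" "v \<noteq> 0\<^sub>v k" "X *\<^sub>v v = 0\<^sub>v k"
    using det_0_iff_vec_prod_zero_field[OF X] by blast
  then have "Re ((X *\<^sub>v v) \<bullet>c v) > 0" using pd X unfolding pos_def_def by auto
  then show False unfolding v(3) using v(1) by simp
qed

subsection \<open>Gramians under a change of coordinates\<close>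

text \<open>The relation \<open>J S = S A\<close> moves \<open>J\<close> past \<open>S\<close> on
  the left, and its adjoint does the same on the right. So congruence by \<open>S\<close> carries
  the Lyapunov operator of \<open>A\<close> to that of \<open>J\<close>.\<close>

lemma lyapunov_congruence:
  fixes J A S X :: "complex mat"
  assumes J: "J \<in> carrier_mat k k" and A: "A \<in> carrier_mat k k" and S: "S \<in> carrier_mat k k"
    and X: "X \<in> carrier_mat k k" and JS: "J * S = S * A"
  shows "J * (S * X * mat_adjoint S) + (S * X * mat_adjoint S) * mat_adjoint J =
    S * (A * X + X * mat_adjoint A) * mat_adjoint S"
proof -
  note adj [simp] = iffD2[OF mat_adjoint_carrier S] iffD2[OF mat_adjoint_carrier J]
    iffD2[OF mat_adjoint_carrier A]
  note assoc = assoc_mult_mat[of _ k k _ k _ k]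
  have JS': "mat_adjoint S * mat_adjoint J = mat_adjoint A * mat_adjoint S"
    using mat_adjoint_mult[OF J S] mat_adjoint_mult[OF S A] JS by simp
  have "J * (S * X * mat_adjoint S) = (J * S) * X * mat_adjoint S"
    using J S X by (simp add: assoc)
  also have "\<dots> = S * (A * X) * mat_adjoint S"
    unfolding JS using A S X by (simp add: assoc)
  finally have 1: "J * (S * X * mat_adjoint S) = S * (A * X) * mat_adjoint S" .
  have "(S * X * mat_adjoint S) * mat_adjoint J = S * X * (mat_adjoint S * mat_adjoint J)"
    using J S X by (simp add: assoc)
  also have "\<dots> = S * (X * mat_adjoint A) * mat_adjoint S"
    unfolding JS' using A S X by (simp add: assoc)
  finally have 2: "(S * X * mat_adjoint S) * mat_adjoint J = S * (X * mat_adjoint A) * mat_adjoint S" .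
  have c: "S * (A * X) \<in> carrier_mat k k" "S * (X * mat_adjoint A) \<in> carrier_mat k k"
    "A * X \<in> carrier_mat k k" "X * mat_adjoint A \<in> carrier_mat k k"
    using A S X by simp_all
  show ?thesis
    unfolding 1 2 mult_add_distrib_mat[OF S c(3,4)] add_mult_distrib_mat[OF c(1,2) adj(1)] ..
qed

text \<open>Applied to \<open>Am\<close> and to \<open>- Ap\<close>, so that one set of lemmas
  covers both groups off the imaginary axis.\<close>

definition stable_mat :: "real mat \<Rightarrow> bool" where
  "stable_mat A \<longleftrightarrow> (\<forall>z. eigenvalue (cmat A) z \<longrightarrow> Re z < 0)"

lemma eigenvalue_uminus:
  fixes A :: "'a::field mat"
  assumes A: "A \<in> carrier_mat k k" and "eigenvalue (- A) z"
  shows "eigenvalue A (- z)"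
proof -
  obtain v where v: "v \<in> carrier_vec k" "v \<noteq> 0\<^sub>v k" "(- A) *\<^sub>v v = z \<cdot>\<^sub>v v"
    using assms unfolding eigenvalue_def eigenvector_def by auto
  have "A *\<^sub>v v = - ((- A) *\<^sub>v v)" using A v(1) by (intro eq_vecI) auto
  also have "\<dots> = (- z) \<cdot>\<^sub>v v" unfolding v(3) by (intro eq_vecI) auto
  finally show ?thesis using A v unfolding eigenvalue_def eigenvector_def by auto
qed

lemma eigenvalue_transpose:
  fixes A :: "'a::field mat"
  assumes A: "A \<in> carrier_mat k k"
  shows "eigenvalue A\<^sup>T z \<longleftrightarrow> eigenvalue A z"
  using eigenvalue_root_char_poly[OF A] eigenvalue_root_char_poly[of "A\<^sup>T" k] A
  by simp

text \<open>The homogeneous equation says that \<open>X\<close> intertwines \<open>A\<close> with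
  minus its adjoint. Their spectra lie in opposite open half-planes, so \<open>X\<close> vanishes by
  \<open>intertwiner_eq_0\<close>.\<close>

lemma stable_lyapunov_injective_cmat:
  assumes A: "A \<in> carrier_mat k k" and st: "stable_mat A"
  shows "\<forall>X \<in> carrier_mat k k. cmat A * X + X * mat_adjoint (cmat A) = 0\<^sub>m k k \<longrightarrow> X = 0\<^sub>m k k"
proof (intro ballI impI)
  fix X :: "complex mat"
  assume X: "X \<in> carrier_mat k k" and eq: "cmat A * X + X * mat_adjoint (cmat A) = 0\<^sub>m k k"
  define B where "B = - mat_adjoint (cmat A)"
  have cA: "cmat A \<in> carrier_mat k k" and aA: "mat_adjoint (cmat A) \<in> carrier_mat k k"
    using A by simp_all
  have B: "B \<in> carrier_mat k k" using aA unfolding B_def by simp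
  have "cmat A * X = X * B"
  proof (rule eq_matI)
    fix i j assume "i < dim_row (X * B)" "j < dim_col (X * B)"
    then have ij: "i < k" "j < k" using X B by auto
    have "(cmat A * X + X * mat_adjoint (cmat A)) $$ (i, j) = 0" unfolding eq using ij by simp
    then have "(cmat A * X) $$ (i, j) + (X * mat_adjoint (cmat A)) $$ (i, j) = 0"
      using A X ij by (simp del: index_mult_mat(1))
    moreover have "X * B = - (X * mat_adjoint (cmat A))"
      unfolding B_def by (rule uminus_mult_right_mat) (use X A in simp)
    ultimately show "(cmat A * X) $$ (i, j) = (X * B) $$ (i, j)"
      using A X ij by (simp add: eq_neg_iff_add_eq_0 del: index_mult_mat(1))
  qed (use A X B in auto)
  \<comment> \<open>Since \<open>A\<close> is real, its adjoint is the transpose, which has the same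
    eigenvalues. A common eigenvalue \<open>z\<close> would make both \<open>z\<close> and
    \<open>- z\<close> eigenvalues of \<open>A\<close>.\<close>
  moreover have False if "eigenvalue (cmat A) z" "eigenvalue B z" for z
  proof -
    have "eigenvalue (cmat A\<^sup>T) (- z)"
      using eigenvalue_uminus[OF aA] that(2) unfolding B_def mat_adjoint_cmat by blast
    moreover have "cmat A\<^sup>T = (cmat A)\<^sup>T" by (rule eq_matI) auto
    ultimately have "eigenvalue (cmat A) (- z)" using eigenvalue_transpose[OF cA] by simp
    then have "Re (- z) < 0" "Re z < 0" using st that(1) unfolding stable_mat_def by blast+
    then show False by simp
  qed
  ultimately show "X = 0\<^sub>m k k" by (rule intertwiner_eq_0[OF cA B X])
qed

lemma cmat_lyapunov:
  assumes A: "A \<in> carrier_mat k k" and X: "X \<in> carrier_mat k k"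
  shows "cmat A * cmat X + cmat X * mat_adjoint (cmat A) = cmat (A * X + X * A\<^sup>T)"
proof -
  have "cmat (A * X + X * A\<^sup>T) = cmat (A * X) + cmat (X * A\<^sup>T)"
    using A X by (intro cmat_add) auto
  then show ?thesis
    using cmat_mult[OF A X] cmat_mult[OF X, of "A\<^sup>T" k] A by (simp add: mat_adjoint_cmat)
qed

text \<open>The real counterpart, obtained by embedding into the complex matrices; it is required
  because \<open>V_minus\<close> and \<open>V_plus\<close> are real solutions.\<close>

lemma stable_lyapunov_injective:
  assumes A: "A \<in> carrier_mat k k" and st: "stable_mat A"
  shows "\<forall>X \<in> carrier_mat k k. A * X + X * A\<^sup>T = 0\<^sub>m k k \<longrightarrow> X = 0\<^sub>m k k"
proof (intro ballI impI)
  fix X assume X: "X \<in> carrier_mat k k" and eq: "A * X + X * A\<^sup>T = 0\<^sub>m k k"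
  have "cmat A * cmat X + cmat X * mat_adjoint (cmat A) = 0\<^sub>m k k"
    unfolding cmat_lyapunov[OF A X] eq by simp
  then have "cmat X = cmat (0\<^sub>m k k)"
    unfolding cmat_zero
    using stable_lyapunov_injective_cmat[OF A st] map_carrier_mat[THEN iffD2, OF X] by blast
  then show "X = 0\<^sub>m k k" by (simp only: cmat_eq_iff)
qed

text \<open>By \<open>lyapunov_congruence\<close> the congruence of \<open>V\<close> by
  \<open>S\<close> solves the equation for \<open>J\<close>, so only uniqueness for \<open>J\<close>
  remains before \<open>sylvester_sol_eqI\<close> applies.\<close>

lemma sylvester_sol_congruence:
  assumes A: "A \<in> carrier_mat k k" and st: "stable_mat A" and G: "G \<in> carrier_mat k k"
    and V: "V \<in> carrier_mat k k" and V_eq: "A * V + V * A\<^sup>T + G = 0\<^sub>m k k"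
    and J: "J \<in> carrier_mat k k" and S: "S \<in> carrier_mat k k" and S': "S' \<in> carrier_mat k k"
    and inv: "S * S' = 1\<^sub>m k" and JS: "J * S = S * cmat A"
  shows "sylvester_sol J (mat_adjoint J) (S * cmat G * mat_adjoint S) = S * cmat V * mat_adjoint S"
proof (rule sylvester_sol_eqI[OF J])
  note cA = map_carrier_mat[THEN iffD2, OF A, of complex_of_real]
  note cV = map_carrier_mat[THEN iffD2, OF V, of complex_of_real]
  note cG = map_carrier_mat[THEN iffD2, OF G, of complex_of_real]
  note adj [simp] = iffD2[OF mat_adjoint_carrier S] iffD2[OF mat_adjoint_carrier S']
    iffD2[OF mat_adjoint_carrier J]
  have inv': "S' * S = 1\<^sub>m k" by (rule mat_mult_left_right_inverse[OF S S' inv])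
  show "mat_adjoint J \<in> carrier_mat k k" using J by simp
  show "S * cmat G * mat_adjoint S \<in> carrier_mat k k" "S * cmat V * mat_adjoint S \<in> carrier_mat k k"
    using S cG cV by simp_all
  have S'J: "cmat A * S' = S' * J"
  proof -
    have "cmat A * S' = S' * (S * cmat A) * S'"
      using cA S S' inv' by (simp add: assoc_mult_mat[of _ k k _ k _ k, symmetric])
    also have "\<dots> = S' * J * (S * S')"
      unfolding JS[symmetric] using J S S' by (simp add: assoc_mult_mat[of _ k k _ k _ k])
    finally show ?thesis unfolding inv using J S' by simp
  qed
  \<comment> \<open>Uniqueness is transferred from \<open>A\<close>: the inverse \<open>S'\<close>
    intertwines in the opposite direction, so a homogeneous solution \<open>X\<close> for
    \<open>J\<close> gives a homogeneous solution \<open>Y\<close> for \<open>A\<close>, and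
    \<open>X\<close> is recovered from \<open>Y\<close>.\<close>
  show "\<forall>X \<in> carrier_mat k k. J * X + X * mat_adjoint J = 0\<^sub>m k k \<longrightarrow> X = 0\<^sub>m k k"
  proof (intro ballI impI)
    fix X assume X: "X \<in> carrier_mat k k" and eq: "J * X + X * mat_adjoint J = 0\<^sub>m k k"
    define Y where "Y = S' * X * mat_adjoint S'"
    have Y: "Y \<in> carrier_mat k k" unfolding Y_def using S' X by simp
    have "cmat A * Y + Y * mat_adjoint (cmat A) = 0\<^sub>m k k"
      unfolding Y_def lyapunov_congruence[OF cA J S' X S'J] eq using S' by simp
    then have "Y = 0\<^sub>m k k" using stable_lyapunov_injective_cmat[OF A st] Y by blast
    moreover have "X = S * Y * mat_adjoint S"
      unfolding Y_def by (rule congruence_inverse[symmetric, OF X S' S inv])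
    ultimately show "X = 0\<^sub>m k k" using S by simp
  qed
  have AV: "A * V + V * A\<^sup>T \<in> carrier_mat k k" using A V by simp
  have "J * (S * cmat V * mat_adjoint S) + S * cmat V * mat_adjoint S * mat_adjoint J =
      S * cmat (A * V + V * A\<^sup>T) * mat_adjoint S"
    unfolding lyapunov_congruence[OF J cA S cV JS] cmat_lyapunov[OF A V] ..
  also have "\<dots> + S * cmat G * mat_adjoint S = S * (cmat (A * V + V * A\<^sup>T) + cmat G) * mat_adjoint S"
    using S cG AV add_mult_distrib_mat[of "S * cmat (A * V + V * A\<^sup>T)" k k "S * cmat G" "mat_adjoint S" k]
      mult_add_distrib_mat[OF S, of "cmat (A * V + V * A\<^sup>T)" k "cmat G"] by simp
  also have "cmat (A * V + V * A\<^sup>T) + cmat G = cmat (A * V + V * A\<^sup>T + G)"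
    by (rule cmat_add[symmetric, OF AV G])
  also have "S * \<dots> * mat_adjoint S = 0\<^sub>m k k"
    unfolding V_eq using S by simp
  finally show "J * (S * cmat V * mat_adjoint S) + S * cmat V * mat_adjoint S * mat_adjoint J +
      S * cmat G * mat_adjoint S = 0\<^sub>m k k" .
qed

text \<open>The form used for both Gramians: with \<open>Am\<close> and the Jordan matrix of
  \<open>jm\<close>, and with the negatives of \<open>Ap\<close> and the Jordan matrix of
  \<open>jp\<close>. Existence of the solutions for the individual \<open>C i\<close> enters
  here.\<close>

lemma gramian_congruence:
  assumes A: "A \<in> carrier_mat k k" and st: "stable_mat A"
    and C: "\<forall>i<dim_vec p. C i \<in> carrier_mat k k"
    and J: "J \<in> carrier_mat k k" and S: "S \<in> carrier_mat k k" and S': "S' \<in> carrier_mat k k"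
    and inv: "S * S' = 1\<^sub>m k" and JS: "J * S = S * cmat A"
  shows "sylvester_sol J (mat_adjoint J) (S * cmat (weighted_sum k p C) * mat_adjoint S) =
    S * cmat (weighted_sum k p (\<lambda>i. sylvester_sol A A\<^sup>T (C i))) * mat_adjoint S"
proof (rule sylvester_sol_congruence[OF A st _ _ _ J S S' inv JS])
  have AT: "A\<^sup>T \<in> carrier_mat k k" using A by simp
  note sol = sylvester_sol[OF A AT _ stable_lyapunov_injective[OF A st]]
  show "A * weighted_sum k p (\<lambda>i. sylvester_sol A A\<^sup>T (C i)) +
      weighted_sum k p (\<lambda>i. sylvester_sol A A\<^sup>T (C i)) * A\<^sup>T + weighted_sum k p C = 0\<^sub>m k k"
    using sol C by (intro weighted_sum_sylvester[OF A AT]) blast+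
qed simp_all

subsection \<open>Three blocks\<close>

lemma mat_part_map_mat:
  assumes "M \<in> carrier_mat (sum_list ns) (sum_list ns)" "i < length ns" "j < length ns"
  shows "mat_part ns (map_mat f M) i j = map_mat f (mat_part ns M i j)"
  using assms block_offset_add_less[of i ns] block_offset_add_less[of j ns]
  by (intro eq_matI) auto

lemma mat_part_mult3:
  fixes M N :: "'a::semiring_0 mat"
  assumes M: "M \<in> carrier_mat (sum_list ns) (sum_list ns)" and N: "N \<in> carrier_mat (sum_list ns) (sum_list ns)"
    and len: "length ns = 3" and ij: "i < length ns" "j < length ns"
  shows "mat_part ns (M * N) i j = mat_part ns M i 0 * mat_part ns N 0 j +
    mat_part ns M i 1 * mat_part ns N 1 j + mat_part ns M i 2 * mat_part ns N 2 j"
proof (rule eq_matI)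
  fix a b
  assume "a < dim_row (mat_part ns M i 0 * mat_part ns N 0 j +
    mat_part ns M i 1 * mat_part ns N 1 j + mat_part ns M i 2 * mat_part ns N 2 j)"
    "b < dim_col (mat_part ns M i 0 * mat_part ns N 0 j +
    mat_part ns M i 1 * mat_part ns N 1 j + mat_part ns M i 2 * mat_part ns N 2 j)"
  then have ab: "a < ns ! i" "b < ns ! j" by simp_all
  show "mat_part ns (M * N) i j $$ (a, b) = (mat_part ns M i 0 * mat_part ns N 0 j +
    mat_part ns M i 1 * mat_part ns N 1 j + mat_part ns M i 2 * mat_part ns N 2 j) $$ (a, b)"
    unfolding mat_part_mult_index[OF M N ij ab] len
    using ab by (simp add: numeral_3_eq_3 numeral_2_eq_2 del: index_mult_mat(1))
qed simp_all

lemma lower_block3_carrier: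
  assumes "A11 \<in> carrier_mat k0 k0" "A21 \<in> carrier_mat k1 k0" "A22 \<in> carrier_mat k1 k1"
    "A31 \<in> carrier_mat k2 k0" "A32 \<in> carrier_mat k2 k1" "A33 \<in> carrier_mat k2 k2"
  shows "lower_block3 A11 A21 A22 A31 A32 A33 \<in> carrier_mat (k0 + (k1 + k2)) (k0 + (k1 + k2))"
  using assms unfolding lower_block3_def by (intro carrier_matI) auto

lemma mat_part_lower_block3:
  assumes "A11 \<in> carrier_mat k0 k0" "A21 \<in> carrier_mat k1 k0" "A22 \<in> carrier_mat k1 k1"
    "A31 \<in> carrier_mat k2 k0" "A32 \<in> carrier_mat k2 k1" "A33 \<in> carrier_mat k2 k2"
  shows "mat_part [k0, k1, k2] (lower_block3 A11 A21 A22 A31 A32 A33) 0 0 = A11"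
    "mat_part [k0, k1, k2] (lower_block3 A11 A21 A22 A31 A32 A33) 0 1 = 0\<^sub>m k0 k1"
    "mat_part [k0, k1, k2] (lower_block3 A11 A21 A22 A31 A32 A33) 0 2 = 0\<^sub>m k0 k2"
    "mat_part [k0, k1, k2] (lower_block3 A11 A21 A22 A31 A32 A33) 1 0 = A21"
    "mat_part [k0, k1, k2] (lower_block3 A11 A21 A22 A31 A32 A33) 1 1 = A22"
    "mat_part [k0, k1, k2] (lower_block3 A11 A21 A22 A31 A32 A33) 1 2 = 0\<^sub>m k1 k2"
    "mat_part [k0, k1, k2] (lower_block3 A11 A21 A22 A31 A32 A33) 2 0 = A31"
    "mat_part [k0, k1, k2] (lower_block3 A11 A21 A22 A31 A32 A33) 2 1 = A32"
    "mat_part [k0, k1, k2] (lower_block3 A11 A21 A22 A31 A32 A33) 2 2 = A33"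
  unfolding lower_block3_def append_rows_def
  using assms by (intro eq_matI; force simp: numeral_2_eq_2)+

lemma det_lower_block3:
  fixes A11 :: "'a::idom mat"
  assumes "A11 \<in> carrier_mat k0 k0" "A21 \<in> carrier_mat k1 k0" "A22 \<in> carrier_mat k1 k1"
    "A31 \<in> carrier_mat k2 k0" "A32 \<in> carrier_mat k2 k1" "A33 \<in> carrier_mat k2 k2"
  shows "det (lower_block3 A11 A21 A22 A31 A32 A33) = det A11 * (det A22 * det A33)"
proof -
  define B where "B = four_block_mat A22 (0\<^sub>m k1 k2) A32 A33"
  have B: "B \<in> carrier_mat (k1 + k2) (k1 + k2)" unfolding B_def using assms by simp
  have "det B = det A22 * det A33"
    unfolding B_def by (rule det_four_block_mat_upper_right_zero[OF assms(3) refl assms(5,6)])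
  moreover have "det (four_block_mat A11 (0\<^sub>m k0 (k1 + k2)) (A21 @\<^sub>r A31) B) = det A11 * det B"
    by (rule det_four_block_mat_upper_right_zero[OF assms(1) refl carrier_append_rows[OF assms(2,4)] B])
  moreover have "lower_block3 A11 A21 A22 A31 A32 A33 =
      four_block_mat A11 (0\<^sub>m k0 (k1 + k2)) (A21 @\<^sub>r A31) B"
    unfolding lower_block3_def B_def using assms by simp
  ultimately show ?thesis by simp
qed

text \<open>Rearranges the defining equations of the blocks of \<open>R2\<close> into the shape in
  which they occur inside a block product.\<close>

lemma add_eq_of_diff_eq_uminus:
  fixes X Y Z :: "'a::ab_group_add mat"
  assumes X: "X \<in> carrier_mat k l" and Y: "Y \<in> carrier_mat k l" and Z: "Z \<in> carrier_mat k l"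
    and eq: "X - Y = - Z"
  shows "Z + X = Y"
proof (rule eq_matI)
  fix i j assume "i < dim_row Y" "j < dim_col Y"
  then have ij: "i < k" "j < l" using Y by auto
  have "(X - Y) $$ (i, j) = (- Z) $$ (i, j)" unfolding eq ..
  then have "X $$ (i, j) - Y $$ (i, j) = - Z $$ (i, j)" using X Y Z ij by simp
  then have "Y $$ (i, j) = Z $$ (i, j) + X $$ (i, j)" by (simp add: algebra_simps)
  then show "(Z + X) $$ (i, j) = Y $$ (i, j)" using X ij by simp
qed (use X Y Z in auto)

text \<open>Compared block by block, the three Sylvester equations are exactly the blocks
  \<open>(1, 0)\<close>, \<open>(2, 1)\<close> and \<open>(2, 0)\<close> of the claim; on and above
  the diagonal both sides agree because \<open>R2\<close> is unit lower triangular.\<close>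

lemma lower_block3_similar_diag:
  fixes Am :: "'a::comm_ring_1 mat"
  assumes L: "Am \<in> carrier_mat nm nm" "A0m \<in> carrier_mat n0 nm" "A0 \<in> carrier_mat n0 n0"
      "Apm \<in> carrier_mat np nm" "Ap0 \<in> carrier_mat np n0" "Ap \<in> carrier_mat np np"
    and R: "R20m \<in> carrier_mat n0 nm" "R2pm \<in> carrier_mat np nm" "R2p0 \<in> carrier_mat np n0"
    and eq_0m: "A0 * R20m - R20m * Am = - A0m"
    and eq_p0: "Ap * R2p0 - R2p0 * A0 = - Ap0"
    and eq_pm: "Ap * R2pm - R2pm * Am = - (Apm + Ap0 * R20m)"
  defines "R2 \<equiv> lower_block3 (1\<^sub>m nm) R20m (1\<^sub>m n0) R2pm R2p0 (1\<^sub>m np)"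
  shows "lower_block3 Am A0m A0 Apm Ap0 Ap * R2 = R2 * diag_block_mat [Am, A0, Ap]"
    (is "?L * _ = _ * diag_block_mat ?D")
proof (rule mat_part_eqI[of _ "[nm, n0, np]"])
  let ?ns = "[nm, n0, np]"
  have cL: "?L \<in> carrier_mat (sum_list ?ns) (sum_list ?ns)"
    using lower_block3_carrier[OF L] by simp
  have cR2: "R2 \<in> carrier_mat (sum_list ?ns) (sum_list ?ns)"
    unfolding R2_def using lower_block3_carrier[OF one_carrier_mat R(1) one_carrier_mat R(2,3) one_carrier_mat]
    by simp
  have D: "map dim_row ?D = ?ns" "map dim_col ?D = ?ns" using L by auto
  show "?L * R2 \<in> carrier_mat (sum_list ?ns) (sum_list ?ns)"
    "R2 * diag_block_mat ?D \<in> carrier_mat (sum_list ?ns) (sum_list ?ns)"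
    using mult_carrier_mat[OF cL cR2] mult_carrier_mat[OF cR2 diag_block_mat_carrier[OF D]] by blast+
  have R2': "mat_part ?ns R2 0 0 = 1\<^sub>m nm" "mat_part ?ns R2 0 1 = 0\<^sub>m nm n0" "mat_part ?ns R2 0 2 = 0\<^sub>m nm np"
    "mat_part ?ns R2 1 0 = R20m" "mat_part ?ns R2 1 1 = 1\<^sub>m n0" "mat_part ?ns R2 1 2 = 0\<^sub>m n0 np"
    "mat_part ?ns R2 2 0 = R2pm" "mat_part ?ns R2 2 1 = R2p0" "mat_part ?ns R2 2 2 = 1\<^sub>m np"
    unfolding R2_def
    by (rule mat_part_lower_block3[OF one_carrier_mat R(1) one_carrier_mat R(2,3) one_carrier_mat])+
  have e1: "A0m + A0 * R20m = R20m * Am"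
    using L R eq_0m by (intro add_eq_of_diff_eq_uminus[of _ n0 nm]) auto
  have e2: "Apm + Ap0 * R20m + Ap * R2pm = R2pm * Am"
    using L R eq_pm by (intro add_eq_of_diff_eq_uminus[of _ np nm]) auto
  have e3: "Ap0 + Ap * R2p0 = R2p0 * A0"
    using L R eq_p0 by (intro add_eq_of_diff_eq_uminus[of _ np n0]) auto
  fix i j assume ij: "i < length ?ns" "j < length ?ns"
  then have i: "i \<in> {0, 1, 2}" and j: "j \<in> {0, 1, 2}" by auto
  have "mat_part ?ns (?L * R2) i j = mat_part ?ns R2 i j * ?D ! j"
    unfolding mat_part_mult3[OF cL cR2 _ ij, simplified]
    using i j L R e1 e2 e3
    by (auto simp: mat_part_lower_block3[OF L, unfolded One_nat_def] R2'[unfolded One_nat_def])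
  then show "mat_part ?ns (?L * R2) i j = mat_part ?ns (R2 * diag_block_mat ?D) i j"
    unfolding mat_part_mult_diag_block_mat[OF D cR2 ij] .
qed

lemma diag_first_mult_unit_lower_block3:
  fixes K :: "'a::comm_ring_1 mat"
  assumes K: "K \<in> carrier_mat nm nm"
    and R: "R20m \<in> carrier_mat n0 nm" "R2pm \<in> carrier_mat np nm" "R2p0 \<in> carrier_mat np n0"
  defines "R2 \<equiv> lower_block3 (1\<^sub>m nm) R20m (1\<^sub>m n0) R2pm R2p0 (1\<^sub>m np)"
  shows "diag_block_mat [K, 0\<^sub>m n0 n0, 0\<^sub>m np np] * R2 = diag_block_mat [K, 0\<^sub>m n0 n0, 0\<^sub>m np np]"
    (is "diag_block_mat ?D * _ = _")
proof (rule mat_part_eqI[of _ "[nm, n0, np]"])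
  let ?ns = "[nm, n0, np]"
  have cR2: "R2 \<in> carrier_mat (sum_list ?ns) (sum_list ?ns)"
    unfolding R2_def using lower_block3_carrier[OF one_carrier_mat R(1) one_carrier_mat R(2,3) one_carrier_mat]
    by simp
  have D: "map dim_row ?D = ?ns" "map dim_col ?D = ?ns" using K by auto
  show "diag_block_mat ?D * R2 \<in> carrier_mat (sum_list ?ns) (sum_list ?ns)"
    "diag_block_mat ?D \<in> carrier_mat (sum_list ?ns) (sum_list ?ns)"
    using mult_carrier_mat[OF diag_block_mat_carrier[OF D] cR2] diag_block_mat_carrier[OF D] by blast+
  have R2': "mat_part ?ns R2 0 0 = 1\<^sub>m nm" "mat_part ?ns R2 0 1 = 0\<^sub>m nm n0" "mat_part ?ns R2 0 2 = 0\<^sub>m nm np"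
    unfolding R2_def
    by (rule mat_part_lower_block3[OF one_carrier_mat R(1) one_carrier_mat R(2,3) one_carrier_mat])+
  fix i j assume ij: "i < length ?ns" "j < length ?ns"
  have "?D ! i * mat_part ?ns R2 i j = (if i = j then ?D ! i else 0\<^sub>m (?ns ! i) (?ns ! j))"
    using ij K mat_part_carrier[of ?ns R2 i j]
    by (auto simp: numeral_3_eq_3 less_Suc_eq R2'[unfolded One_nat_def numeral_2_eq_2])
  then show "mat_part ?ns (diag_block_mat ?D * R2) i j = mat_part ?ns (diag_block_mat ?D) i j"
    unfolding mat_part_diag_block_mat_mult[OF D cR2 ij] mat_part_diag_block_mat[OF D ij] .
qed

subsection \<open>Traces and determinants\<close>

lemma mat_trace_mult_commute:
  fixes M N :: "'a::comm_semiring_0 mat"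
  assumes "M \<in> carrier_mat k l" "N \<in> carrier_mat l k"
  shows "mat_trace (M * N) = mat_trace (N * M)"
proof -
  have "mat_trace (M * N) = (\<Sum>i<k. \<Sum>j<l. M $$ (i, j) * N $$ (j, i))"
    using assms by (simp add: mat_trace_def scalar_prod_def atLeast0LessThan)
  also have "\<dots> = (\<Sum>j<l. \<Sum>i<k. N $$ (j, i) * M $$ (i, j))"
    by (subst sum.swap) (simp add: mult.commute)
  also have "\<dots> = mat_trace (N * M)"
    using assms by (simp add: mat_trace_def scalar_prod_def atLeast0LessThan)
  finally show ?thesis .
qed

lemma mat_trace_diag_first:
  fixes K :: "'a::comm_monoid_add mat"
  assumes "K \<in> carrier_mat k k"
  shows "mat_trace (diag_block_mat [K, 0\<^sub>m l l, 0\<^sub>m m m]) = mat_trace K"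
  using assms by (simp add: mat_trace_def sum_lessThan_add)

lemma mat_trace_cmat: "dim_row M = dim_col M \<Longrightarrow> mat_trace (cmat M) = complex_of_real (mat_trace M)"
  by (simp add: mat_trace_def)

lemma det_mat_adjoint:
  fixes S :: "complex mat"
  assumes "S \<in> carrier_mat k k"
  shows "det (mat_adjoint S) = cnj (det S)"
proof -
  interpret cnj: comm_ring_hom cnj by unfold_locales auto
  have "mat_adjoint S = (map_mat cnj S)\<^sup>T" by (rule eq_matI) auto
  then show ?thesis using assms by (simp add: det_transpose[of _ k] cnj.hom_det)
qed

subsection \<open>Jordan matrices\<close>

lemma eigenvalue_jordan_matrix:
  fixes z :: complex
  assumes "eigenvalue (jordan_matrix bs) z"
  shows "z \<in> snd ` set bs"
proof -
  have "poly (\<Prod>(k, a)\<leftarrow>bs. [:- a, 1:] ^ k) z = 0"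
    using assms unfolding eigenvalue_root_char_poly[OF jordan_matrix_carrier] jordan_matrix_char_poly .
  then show ?thesis by (induction bs) (auto split: prod.splits)
qed

text \<open>A block of positive size contributes a factor of the characteristic polynomial that
  vanishes at \<open>z\<close>; a block of size zero would contribute only the factor one.\<close>

lemma eigenvalue_if_jordan_block:
  fixes z :: complex
  assumes "A \<in> carrier_mat n n" "similar_mat A (jordan_matrix bs)" "(k, z) \<in> set bs" "k > 0"
  shows "eigenvalue A z"
proof -
  have "poly (\<Prod>(k, a)\<leftarrow>bs. [:- a, 1:] ^ k) z = 0"
    using assms(3,4) by (induction bs) auto
  then show ?thesis
    unfolding eigenvalue_root_char_poly[OF assms(1)] char_poly_similar[OF assms(2)] jordan_matrix_char_poly .
qed

lemma block_index_replicate_1: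
  assumes "a < k"
  shows "block_index (replicate k 1) a = a"
  unfolding block_index_def
proof (rule Least_equality)
  show "a < block_offset (replicate k 1) (Suc a)"
    using assms by (simp add: block_offset_replicate)
  fix y assume "a < block_offset (replicate k 1) (Suc y)"
  then show "a \<le> y" by (simp add: block_offset_def sum_list_replicate)
qed

lemma mat_of_blocks_replicate_1:
  "mat_of_blocks (replicate k 1) F = mat k k (\<lambda>(a, b). F a b $$ (0, 0))"
  by (rule eq_matI)
    (simp_all add: mat_of_blocks_def sum_list_replicate block_index_replicate_1 block_offset_replicate
      del: replicate_Suc One_nat_def)

text \<open>There is a single group, for the eigenvalue zero. Each Jordan block has size one, so the
  lower-right entry of a block of \<open>B_tilde\<close> is the whole block and the coefficient
  matrix has the single entry \<open>1 / (0! 0! 1) = 1\<close>.\<close>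

lemma W_zero_semisimple:
  assumes j0: "j0 = replicate k (1, 0)"
  shows "W_zero Q jm j0 jp p =
    mat_part [total_size jm, total_size j0, total_size jp] (B_tilde Q p) 1 1"
proof (cases "k = 0")
  \<comment> \<open>Without blocks the list of distinct eigenvalues is empty, and both sides are the
    empty matrix; otherwise it is \<open>[0]\<close>.\<close>
  case True
  then show ?thesis
    by (intro eq_matI) (simp_all add: W_zero_def distinct_eigenvalues_def j0 total_size_def)
next
  case False
  let ?bs = "jm @ j0 @ jp"
  have size: "total_size j0 = k" by (simp add: j0 total_size_def map_replicate_const sum_list_replicate)
  have ev: "distinct_eigenvalues j0 = [0]"
  proof -
    have "remdups (replicate (Suc m) x) = [x]" for m and x :: complex
      by (induction m) auto
    then show ?thesis
      using False unfolding j0 distinct_eigenvalues_def map_replicate snd_conv by (cases k) blast+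
  qed
  have num: "num_blocks j0 0 = k" by (simp add: num_blocks_def ev) (simp add: j0)
  have nth': "(j0 @ jp) ! i = (1, 0)" if "i < k" for i
    using that by (simp add: nth_append j0)
  have nth: "?bs ! (length jm + i) = (1, 0)" if "i < k" for i
    using that by (simp add: nth_append j0)
  \<comment> \<open>All blocks of \<open>j0\<close> have size one, so after the blocks of
    \<open>jm\<close> the offset grows by one per block.\<close>
  have off: "block_offset (map fst ?bs) (length jm + i) = total_size jm + i" if "i < k" for i
    using that by (simp add: block_offset_def total_size_def j0 sum_list_replicate min_def)
  have part: "b_tilde Q ?bs p (length jm + i) (length jm + j) = B_tilde Q p $$ (total_size jm + i, total_size jm + j)"
    if "i < k" "j < k" for i j
    using that j0 unfolding b_tilde_def nth[OF that(1)] nth[OF that(2)] mat_part_def off[OF that(1)] off[OF that(2)]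
    by (simp add: nth_append)
  have "W_zero_group Q jm j0 jp p 0 = mat k k (\<lambda>(a, b). B_tilde Q p $$ (total_size jm + a, total_size jm + b))"
  proof -
    have "map fst (take (num_blocks j0 0) (drop (length jm) ?bs)) = replicate k 1"
      unfolding num by (simp add: j0 map_replicate_const)
    then show ?thesis
      unfolding W_zero_group_def Let_def
      by (intro eq_matI)
        (simp_all add: mat_of_blocks_replicate_1 part nth' C_coeff_def del: One_nat_def)
  qed
  then have "W_zero Q jm j0 jp p = mat k k (\<lambda>(a, b). B_tilde Q p $$ (total_size jm + a, total_size jm + b))"
    unfolding W_zero_def ev by (simp del: diag_block_mat.simps)
  also have "\<dots> = mat_part [total_size jm, total_size j0, total_size jp] (B_tilde Q p) 1 1"
    by (rule eq_matI) (simp_all add: size mat_part_def block_offset_def)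
  finally show ?thesis .
qed

subsection \<open>The change of coordinates between the two constructions\<close>

text \<open>Collects the data of the two constructions. The conditions on the imaginary axis enter
  later, in the form \<open>j0 = replicate k (1, 0)\<close>, as a premise of the lemmas that involve
  \<open>W_zero\<close>.\<close>

locale jordan_schur =
  fixes n nm n0 np :: nat
    and A R1 Am A0m A0 Apm Ap0 Ap R20m R2p0 R2pm R :: "real mat"
    and Q :: "complex mat"
    and jm j0 jp :: jblocks
  assumes A: "A \<in> carrier_mat n n"
    and jordan: "ordered_jordan_decomposition n (cmat A) Q jm j0 jp"
    and sizes: "nm = total_size jm" "n0 = total_size j0" "np = total_size jp"
    and schur: "block_schur_decomposition n nm n0 np A R1 Am A0m A0 Apm Ap0 Ap"
    and R2_dims: "R20m \<in> carrier_mat n0 nm" "R2p0 \<in> carrier_mat np n0" "R2pm \<in> carrier_mat np nm"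
    and R2_0m: "A0 * R20m - R20m * Am = - A0m"
    and R2_p0: "Ap * R2p0 - R2p0 * A0 = - Ap0"
    and R2_pm: "Ap * R2pm - R2pm * Am = - (Apm + Ap0 * R20m)"
    and R: "R = R1 * lower_block3 (1\<^sub>m nm) R20m (1\<^sub>m n0) R2pm R2p0 (1\<^sub>m np)"
begin

abbreviation "ns \<equiv> [nm, n0, np]"
abbreviation "R2 \<equiv> lower_block3 (1\<^sub>m nm) R20m (1\<^sub>m n0) R2pm R2p0 (1\<^sub>m np)"
abbreviation "L \<equiv> lower_block3 Am A0m A0 Apm Ap0 Ap"
abbreviation "Ds \<equiv> [Am, A0, Ap]"
abbreviation "Js \<equiv> [jordan_matrix jm, jordan_matrix j0, jordan_matrix jp]"

definition S :: "complex mat" where "S = minv Q * cmat R"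
definition S_block :: "nat \<Rightarrow> complex mat" where "S_block i = mat_part ns S i i"

lemma schur_blocks:
  shows "R1 \<in> carrier_mat n n" "R1\<^sup>T * R1 = 1\<^sub>m n"
    and L_blocks: "Am \<in> carrier_mat nm nm" "A0m \<in> carrier_mat n0 nm" "A0 \<in> carrier_mat n0 n0"
      "Apm \<in> carrier_mat np nm" "Ap0 \<in> carrier_mat np n0" "Ap \<in> carrier_mat np np"
    and R1_L: "R1\<^sup>T * A * R1 = L"
  using schur unfolding block_schur_decomposition_def by auto

lemma Q_carrier: "Q \<in> carrier_mat n n" and det_Q: "det Q \<noteq> 0"
proof -
  show Q: "Q \<in> carrier_mat n n" using jordan unfolding ordered_jordan_decomposition_def by auto
  obtain B where "inverts_mat Q B" "inverts_mat B Q"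
    using jordan unfolding ordered_jordan_decomposition_def invertible_mat_def by auto
  then have B: "Q * B = 1\<^sub>m n" "B * Q = 1\<^sub>m (dim_row B)"
    using Q unfolding inverts_mat_def by auto
  \<comment> \<open>\<open>inverts_mat\<close> does not fix the size of \<open>B\<close>; it is
    found by comparing the column numbers in the two product identities.\<close>
  have "dim_col B = n" using arg_cong[OF B(1), of dim_col] by simp
  moreover have "dim_row B = n" using arg_cong[OF B(2), of dim_col] Q by simp
  ultimately have "B \<in> carrier_mat n n" by (rule carrier_matI[rotated])
  then show "det Q \<noteq> 0" using B(1) by (rule det_nonzero_if_inverse[OF Q])
qed

lemmas minv_Q = minv_inverse[OF Q_carrier det_Q]

lemma Q_jordan: "minv Q * cmat A * Q = jordan_matrix (jm @ j0 @ jp)"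
  using jordan unfolding ordered_jordan_decomposition_def by auto

lemma n_eq: "n = nm + (n0 + np)"
proof -
  have "dim_col (minv Q * cmat A * Q) = dim_col (jordan_matrix (jm @ j0 @ jp))"
    unfolding Q_jordan ..
  then show ?thesis using Q_carrier sizes by (simp add: total_size_def)
qed

lemma sum_ns: "sum_list ns = n"
  by (simp add: n_eq)

lemma Ds_dims: "map dim_row Ds = ns" "map dim_col Ds = ns"
  using L_blocks by auto

lemma Js_dims: "map dim_row Js = ns" "map dim_col Js = ns"
  using sizes by (auto simp: total_size_def)

lemma cDs_dims: "map dim_row (map cmat Ds) = ns" "map dim_col (map cmat Ds) = ns"
  using L_blocks by auto

lemma diag_J: "jordan_matrix (jm @ j0 @ jp) = diag_block_mat Js"
  using jordan_matrix_concat_diag_block_mat[of "[jm, j0, jp]"] by (simp del: diag_block_mat.simps)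

lemma R2_carrier: "R2 \<in> carrier_mat n n"
  using lower_block3_carrier[OF one_carrier_mat R2_dims(1) one_carrier_mat R2_dims(3,2) one_carrier_mat]
  unfolding n_eq .

lemma L_carrier: "L \<in> carrier_mat n n"
  using lower_block3_carrier[OF L_blocks] unfolding n_eq .

lemma R_carrier: "R \<in> carrier_mat n n"
  unfolding R using schur_blocks(1) R2_carrier by simp

lemma R1_orthogonal: "R1 * R1\<^sup>T = 1\<^sub>m n"
  using mat_mult_left_right_inverse[OF _ schur_blocks(1,2)] schur_blocks(1) by simp

lemma det_R: "det R \<noteq> 0"
proof -
  have "det R1 \<noteq> 0"
    using det_nonzero_if_inverse[OF schur_blocks(1) _ R1_orthogonal] schur_blocks(1) by simp
  moreover have "det R2 = 1"
    using det_lower_block3[OF one_carrier_mat R2_dims(1) one_carrier_mat R2_dims(3,2) one_carrier_mat]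
    by simp
  ultimately show ?thesis
    unfolding R det_mult[OF schur_blocks(1) R2_carrier] by simp
qed

lemmas minv_R = minv_inverse[OF R_carrier det_R]

lemma D_carrier: "diag_block_mat Ds \<in> carrier_mat n n"
  using diag_block_mat_carrier[OF Ds_dims] unfolding sum_ns .

text \<open>\<open>R1\<close> leads to the block triangular \<open>L\<close>, and \<open>R2\<close>
  clears the blocks below the diagonal. In this multiplied-out form the identity can be inserted
  directly into the product \<open>minv Q * A * R\<close> in \<open>J_S\<close>.\<close>

lemma A_R: "A * R = R * diag_block_mat Ds"
proof -
  note assoc = assoc_mult_mat[of _ n n _ n _ n]
  note R1 = schur_blocks(1)
  have "A * R1 = (R1 * R1\<^sup>T) * (A * R1)"
    unfolding R1_orthogonal using left_mult_one_mat[OF mult_carrier_mat[OF A R1]] by simp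
  also have "\<dots> = R1 * (R1\<^sup>T * A * R1)"
    using R1 A transpose_carrier_mat[THEN iffD2, OF R1] by (simp add: assoc)
  finally have AR1: "A * R1 = R1 * L" unfolding R1_L .
  have "A * R = A * R1 * R2" unfolding R using assoc[OF A R1 R2_carrier] by simp
  also have "\<dots> = R1 * (L * R2)" unfolding AR1 by (rule assoc[OF R1 L_carrier R2_carrier])
  also have "L * R2 = R2 * diag_block_mat Ds"
    by (rule lower_block3_similar_diag[OF L_blocks R2_dims(1,3,2) R2_0m R2_p0 R2_pm])
  also have "R1 * \<dots> = R * diag_block_mat Ds"
    unfolding R by (rule assoc[symmetric, OF R1 R2_carrier D_carrier])
  finally show ?thesis .
qed

lemma S_carrier: "S \<in> carrier_mat n n"
  unfolding S_def using minv_Q(1) R_carrier by simp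

lemma det_S: "det S \<noteq> 0"
proof -
  have "det (minv Q) \<noteq> 0"
    by (rule det_nonzero_if_inverse[OF minv_Q(1) Q_carrier minv_Q(3)])
  moreover have "det (cmat R) \<noteq> 0" using det_R by (simp add: of_real_hom.hom_det)
  ultimately show ?thesis
    unfolding S_def using det_mult[OF minv_Q(1), of "cmat R"] R_carrier by simp
qed

lemma cD_eq: "cmat (diag_block_mat Ds) = diag_block_mat (map cmat Ds)"
  by (rule map_mat_diag_block_mat) simp

lemma J_S: "diag_block_mat Js * S = S * diag_block_mat (map cmat Ds)"
proof -
  note assoc = assoc_mult_mat[of _ n n _ n _ n]
  have c: "cmat A \<in> carrier_mat n n" "cmat R \<in> carrier_mat n n" "cmat (diag_block_mat Ds) \<in> carrier_mat n n"
    using A R_carrier D_carrier by (simp_all only: map_carrier_mat)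
  have cAR: "cmat A * cmat R \<in> carrier_mat n n" by (rule mult_carrier_mat[OF c(1,2)])
  have "diag_block_mat Js * S = minv Q * (cmat A * ((Q * minv Q) * cmat R))"
    unfolding S_def diag_J[symmetric] Q_jordan[symmetric]
    using minv_Q(1) Q_carrier c by (simp add: assoc del: map_carrier_mat)
  also have "\<dots> = minv Q * cmat (A * R)"
    unfolding minv_Q(2) left_mult_one_mat[OF c(2)] cmat_mult[OF A R_carrier] ..
  also have "\<dots> = S * cmat (diag_block_mat Ds)"
    unfolding A_R S_def cmat_mult[OF R_carrier D_carrier]
    by (rule assoc[symmetric, OF minv_Q(1) c(2,3)])
  finally show ?thesis unfolding cD_eq .
qed

text \<open>The expression \<open>real i - 1\<close> takes the values -1, 0, 1 on the three groups.
  Encoding the sign of the real part this way yields disjointness for all pairs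
  \<open>i \<noteq> j\<close> at once.\<close>

lemma spectra:
  assumes "i < length ns"
  shows "eigenvalue (Js ! i) z \<Longrightarrow> sgn (Re z) = real i - 1"
    and "eigenvalue (map cmat Ds ! i) z \<Longrightarrow> sgn (Re z) = real i - 1"
proof -
  have i: "i \<in> {0, 1, 2}" using assms by auto
  have j: "\<forall>(k, l)\<in>set jm. Re l < 0" "\<forall>(k, l)\<in>set j0. Re l = 0" "\<forall>(k, l)\<in>set jp. Re l > 0"
    using jordan unfolding ordered_jordan_decomposition_def by auto
  show "eigenvalue (Js ! i) z \<Longrightarrow> sgn (Re z) = real i - 1"
    using i j eigenvalue_jordan_matrix[of _ z] by fastforce
  have d: "eigenvalue (cmat Am) z \<Longrightarrow> Re z < 0" "eigenvalue (cmat A0) z \<Longrightarrow> Re z = 0"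
    "eigenvalue (cmat Ap) z \<Longrightarrow> Re z > 0"
    using schur unfolding block_schur_decomposition_def by auto
  then show "eigenvalue (map cmat Ds ! i) z \<Longrightarrow> sgn (Re z) = real i - 1"
    using i by auto
qed

lemma S_carrier_ns: "S \<in> carrier_mat (sum_list ns) (sum_list ns)"
  using S_carrier unfolding sum_ns .

lemma S_intertwines:
  assumes ij: "i < length ns" "j < length ns"
  shows "Js ! i * mat_part ns S i j = mat_part ns S i j * map cmat Ds ! j"
  using arg_cong[OF J_S, of "\<lambda>M. mat_part ns M i j"]
  unfolding mat_part_diag_block_mat_mult[OF Js_dims S_carrier_ns ij]
    mat_part_mult_diag_block_mat[OF cDs_dims S_carrier_ns ij] .

lemma S_diag: "S = diag_block_mat (map S_block [0..<3])"
proof -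
  have "mat_part ns S i j = 0\<^sub>m (ns ! i) (ns ! j)"
    if ij: "i < length ns" "j < length ns" "i \<noteq> j" for i j
  proof (rule intertwiner_eq_0[OF diag_block_mat_nth_carrier[OF Js_dims ij(1)]
        diag_block_mat_nth_carrier[OF cDs_dims ij(2)] mat_part_carrier S_intertwines[OF ij(1,2)]])
    fix z assume "eigenvalue (Js ! i) z" "eigenvalue (map cmat Ds ! j) z"
    then show False using spectra(1)[OF ij(1), of z] spectra(2)[OF ij(2), of z] ij(3) by simp
  qed
  from diag_block_mat_parts[OF S_carrier_ns this] show ?thesis
    by (simp add: S_block_def numeral_3_eq_3 del: diag_block_mat.simps)
qed

lemma S_block_carrier: "S_block i \<in> carrier_mat (ns ! i) (ns ! i)"
  by (simp add: S_block_def)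

lemma S_blocks_dims: "map dim_row (map S_block [0..<3]) = ns" "map dim_col (map S_block [0..<3]) = ns"
  by (simp_all add: S_block_def upt_rec)

lemma det_S_block:
  assumes "i < 3"
  shows "det (S_block i) \<noteq> 0"
proof -
  have "det S = prod_list (map det (map S_block [0..<3]))"
    unfolding S_diag by (rule det_diag_block_mat) (auto simp: S_block_def)
  then show ?thesis using det_S assms by (auto simp: prod_list_zero_iff)
qed

lemma S_block_intertwines:
  assumes "i < length ns"
  shows "Js ! i * S_block i = S_block i * cmat (Ds ! i)"
proof -
  have "map cmat Ds ! i = cmat (Ds ! i)" using assms by (intro nth_map) simp
  then show ?thesis using S_intertwines[OF assms assms] unfolding S_block_def by metis
qed

lemma S_block_inverse:
  assumes "i < 3"
  obtains S' where "S' \<in> carrier_mat (ns ! i) (ns ! i)" "S_block i * S' = 1\<^sub>m (ns ! i)"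
  using inverse_ofE[OF S_block_carrier det_S_block[OF assms]] by blast

section \<open>The scaled Gramian in the coordinates given by \<open>R\<close>\<close>

lemma minv_Q_eq: "minv Q = S * cmat (minv R)"
proof -
  have "cmat R * cmat (minv R) = 1\<^sub>m n"
    unfolding cmat_mult[OF R_carrier minv_R(1), symmetric] minv_R(2) by (rule of_real_hom.mat_hom_one)
  moreover have "S * cmat (minv R) = minv Q * (cmat R * cmat (minv R))"
    unfolding S_def by (rule assoc_mult_mat[OF minv_Q(1)]) (use R_carrier minv_R(1) in auto)
  ultimately show ?thesis using minv_Q(1) by simp
qed

abbreviation "scaled_gram p \<equiv> minv R * mat_diag n (\<lambda>i. p $ i) * (minv R)\<^sup>T"

lemma scaled_gram_carrier: "scaled_gram p \<in> carrier_mat n n"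
  by (rule mult_carrier_mat[OF mult_carrier_mat[OF minv_R(1) mat_diag_dim]])
    (rule transpose_carrier_mat[THEN iffD2, OF minv_R(1)])

text \<open>With \<open>x_i\<close> the \<open>i\<close>-th column of \<open>minv R\<close>, the
  matrix is the sum of \<open>p_i x_i x_i^T\<close>. Its diagonal block \<open>h\<close> only sees
  part \<open>h\<close> of each column, which is \<open>r_part\<close>.\<close>

lemma scaled_gram_part:
  assumes h: "h < length ns" and p: "dim_vec p = n"
  shows "mat_part ns (scaled_gram p) h h = weighted_sum (ns ! h) p (\<lambda>i. outer_square (r_part ns R h i))"
proof (rule eq_matI)
  fix a b
  assume "a < dim_row (weighted_sum (ns ! h) p (\<lambda>i. outer_square (r_part ns R h i)))"
    "b < dim_col (weighted_sum (ns ! h) p (\<lambda>i. outer_square (r_part ns R h i)))"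
  then have ab: "a < ns ! h" "b < ns ! h" by simp_all
  have off: "block_offset ns h + a < n" "block_offset ns h + b < n"
    using block_offset_add_less[OF h ab(1)] block_offset_add_less[OF h ab(2)] unfolding sum_ns .
  have r: "r_part ns R h i $ c = minv R $$ (block_offset ns h + c, i)"
    if "i < n" "c < ns ! h" "block_offset ns h + c < n" for i c
    using that R_carrier minv_R(1) by (simp add: r_part_def vec_part_def)
  have [simp]: "dim_vec (r_part ns R h i) = ns ! h" for i by (simp add: r_part_def vec_part_def)
  have "mat_part ns (scaled_gram p) h h $$ (a, b) =
      (\<Sum>i<n. minv R $$ (block_offset ns h + a, i) * p $ i * minv R $$ (block_offset ns h + b, i))"
    using ab off minv_R(1)
    by (simp add: mat_diag_mult_right[OF minv_R(1)] scalar_prod_def atLeast0LessThan)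
  also have "\<dots> = (\<Sum>i<n. p $ i * (r_part ns R h i $ a * r_part ns R h i $ b))"
    using ab off by (intro sum.cong refl) (simp add: r)
  also have "\<dots> = weighted_sum (ns ! h) p (\<lambda>i. outer_square (r_part ns R h i)) $$ (a, b)"
    using ab p by (simp add: outer_square_def)
  finally show "mat_part ns (scaled_gram p) h h $$ (a, b) =
    weighted_sum (ns ! h) p (\<lambda>i. outer_square (r_part ns R h i)) $$ (a, b)" .
qed simp_all

lemma adjoint_S_diag: "mat_adjoint S = diag_block_mat (map mat_adjoint (map S_block [0..<3]))"
  by (subst S_diag) (rule mat_adjoint_diag_block_mat)

text \<open>Because \<open>S\<close> is block diagonal, the diagonal block \<open>h\<close> of
  \<open>S G S^*\<close> depends on \<open>G\<close> only through its own diagonal block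
  \<open>h\<close>.\<close>

lemma B_tilde_part:
  assumes h: "h < length ns" and p: "dim_vec p = n"
  shows "mat_part ns (B_tilde Q p) h h = S_block h *
    cmat (weighted_sum (ns ! h) p (\<lambda>i. outer_square (r_part ns R h i))) * mat_adjoint (S_block h)"
proof -
  note assoc = assoc_mult_mat[of _ n n _ n _ n]
  let ?D = "mat_diag n (\<lambda>i. p $ i)"
  have cR: "cmat (minv R) \<in> carrier_mat n n" and cD: "cmat ?D \<in> carrier_mat n n"
    using minv_R(1) by simp_all
  have cRT: "cmat (minv R)\<^sup>T \<in> carrier_mat n n" using minv_R(1) by simp
  have RD: "minv R * ?D \<in> carrier_mat n n" using minv_R(1) by simp
  have "mat_diag n (\<lambda>i. complex_of_real (p $ i)) = cmat ?D"
    by (rule eq_matI) (auto simp: mat_diag_def)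
  then have "B_tilde Q p = S * cmat (minv R) * cmat ?D * mat_adjoint (S * cmat (minv R))"
    unfolding B_tilde_def p minv_Q_eq by simp
  also have "\<dots> = S * (cmat (minv R) * cmat ?D * cmat (minv R)\<^sup>T) * mat_adjoint S"
    unfolding mat_adjoint_mult[OF S_carrier cR] mat_adjoint_cmat
    using S_carrier cR cD cRT mat_adjoint_carrier[THEN iffD2, OF S_carrier]
    by (simp add: assoc del: map_carrier_mat mat_adjoint_carrier)
  also have "cmat (minv R) * cmat ?D * cmat (minv R)\<^sup>T = cmat (scaled_gram p)"
    using cmat_mult[OF RD, of "(minv R)\<^sup>T" n] cmat_mult[OF minv_R(1), of ?D n] minv_R(1) by simp
  finally have B: "B_tilde Q p = S * cmat (scaled_gram p) * mat_adjoint S" .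
  have G: "cmat (scaled_gram p) \<in> carrier_mat (sum_list ns) (sum_list ns)"
    "scaled_gram p \<in> carrier_mat (sum_list ns) (sum_list ns)"
    using scaled_gram_carrier[of p] unfolding sum_ns by (simp_all only: map_carrier_mat)
  have SG: "S * cmat (scaled_gram p) \<in> carrier_mat (sum_list ns) (sum_list ns)"
    using mult_carrier_mat[OF S_carrier_ns G(1)] .
  have dims: "map dim_row (map mat_adjoint (map S_block [0..<3])) = ns"
    "map dim_col (map mat_adjoint (map S_block [0..<3])) = ns"
    by (simp_all add: S_block_def upt_rec)
  have "mat_part ns (S * cmat (scaled_gram p)) h h = map S_block [0..<3] ! h * mat_part ns (cmat (scaled_gram p)) h h"
    by (subst S_diag) (rule mat_part_diag_block_mat_mult[OF S_blocks_dims G(1) h h])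
  then have "mat_part ns (B_tilde Q p) h h = map S_block [0..<3] ! h * mat_part ns (cmat (scaled_gram p)) h h *
      map mat_adjoint (map S_block [0..<3]) ! h"
    unfolding B unfolding adjoint_S_diag mat_part_mult_diag_block_mat[OF dims SG h h] by (rule arg_cong)
  then show ?thesis
    unfolding mat_part_map_mat[OF G(2) h h] scaled_gram_part[OF h p] using h by simp
qed

lemma outer_square_carrier: "outer_square (r_part ns R h i) \<in> carrier_mat (ns ! h) (ns ! h)"
  by (simp add: outer_square_def r_part_def vec_part_def)

lemma W_minus_eq:
  assumes p: "dim_vec p = n"
  shows "W_minus Q jm j0 jp p = S_block 0 * cmat (V_minus ns R Am p) * mat_adjoint (S_block 0)"
proof -
  have st: "stable_mat Am" using schur unfolding block_schur_decomposition_def stable_mat_def by blast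
  have J: "jordan_matrix jm \<in> carrier_mat nm nm" "jordan_matrix jm * S_block 0 = S_block 0 * cmat Am"
    using sizes S_block_intertwines[of 0] by (simp_all add: total_size_def)
  obtain S' where S': "S' \<in> carrier_mat nm nm" "S_block 0 * S' = 1\<^sub>m nm"
    using S_block_inverse[of 0] by auto
  have S0: "S_block 0 \<in> carrier_mat nm nm" using S_block_carrier[of 0] by simp
  have C: "\<forall>i<dim_vec p. outer_square (r_part ns R 0 i) \<in> carrier_mat nm nm"
    using outer_square_carrier[of 0] by simp
  have part: "mat_part ns (B_tilde Q p) 0 0 = S_block 0 *
      cmat (weighted_sum nm p (\<lambda>i. outer_square (r_part ns R 0 i))) * mat_adjoint (S_block 0)"
    using B_tilde_part[of 0, OF _ p] by simp
  show ?thesis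
    unfolding W_minus_def sizes[symmetric] part V_minus_def nth_Cons_0
    by (rule gramian_congruence[OF L_blocks(1) st C J(1) S0 S' J(2)])
qed

text \<open>After negating \<open>Ap\<close> and the Jordan matrix the argument is that of the
  stable group: the spectrum moves to the left half-plane, and the same block of \<open>S\<close>
  intertwines the negatives.\<close>

lemma W_plus_eq:
  assumes p: "dim_vec p = n"
  shows "W_plus Q jm j0 jp p = S_block 2 * cmat (V_plus ns R Ap p) * mat_adjoint (S_block 2)"
proof -
  have Ap: "Ap \<in> carrier_mat np np" "- Ap \<in> carrier_mat np np" using L_blocks(6) by simp_all
  have cAp: "cmat (- Ap) = - cmat Ap" by (rule eq_matI) auto
  have st: "stable_mat (- Ap)"
    unfolding stable_mat_def
  proof (intro allI impI)
    fix z assume "eigenvalue (cmat (- Ap)) z"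
    then have "eigenvalue (cmat Ap) (- z)"
      unfolding cAp by (rule eigenvalue_uminus[rotated]) (use Ap(1) in simp)
    then have "Re (- z) > 0" using schur unfolding block_schur_decomposition_def by blast
    then show "Re z < 0" by simp
  qed
  have S2: "S_block 2 \<in> carrier_mat np np" using S_block_carrier[of 2] by simp
  have J: "- jordan_matrix jp \<in> carrier_mat np np" "jordan_matrix jp \<in> carrier_mat np np"
    using sizes by (simp_all add: total_size_def)
  have "(- jordan_matrix jp) * S_block 2 = - (jordan_matrix jp * S_block 2)"
    by (rule uminus_mult_left_mat) (simp only: carrier_matD[OF J(2)] carrier_matD[OF S2])
  also have "jordan_matrix jp * S_block 2 = S_block 2 * cmat Ap"
    using S_block_intertwines[of 2] by simp
  also have "- (S_block 2 * cmat Ap) = S_block 2 * cmat (- Ap)"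
    unfolding cAp by (rule uminus_mult_right_mat[symmetric]) (use Ap S2 in simp)
  finally have JS: "(- jordan_matrix jp) * S_block 2 = S_block 2 * cmat (- Ap)" .
  have adj: "- mat_adjoint (jordan_matrix jp) = mat_adjoint (- jordan_matrix jp)"
    by (rule eq_matI) auto
  have tr: "- Ap\<^sup>T = (- Ap)\<^sup>T" by (rule eq_matI) auto
  obtain S' where S': "S' \<in> carrier_mat np np" "S_block 2 * S' = 1\<^sub>m np"
    using S_block_inverse[of 2] by auto
  have C: "\<forall>i<dim_vec p. outer_square (r_part ns R 2 i) \<in> carrier_mat np np"
    using outer_square_carrier[of 2] by simp
  have nth: "ns ! 2 = np" by simp
  have part: "mat_part ns (B_tilde Q p) 2 2 = S_block 2 *
      cmat (weighted_sum np p (\<lambda>i. outer_square (r_part ns R 2 i))) * mat_adjoint (S_block 2)"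
    using B_tilde_part[of 2, OF _ p] by simp
  show ?thesis
    unfolding W_plus_def sizes[symmetric] part V_plus_def nth adj tr
    by (rule gramian_congruence[OF Ap(2) st C J(1) S2 S' JS])
qed

lemma S_diag_blocks: "S = diag_block_mat [S_block 0, S_block 1, S_block 2]"
  using S_diag by (simp add: upt_rec numeral_2_eq_2 del: diag_block_mat.simps)

lemma V_carrier:
  "V_minus ns R Am p \<in> carrier_mat nm nm" "V_zero ns R p \<in> carrier_mat n0 n0" "V_plus ns R Ap p \<in> carrier_mat np np"
  by (simp_all add: V_minus_def V_zero_def V_plus_def)

lemma V_all_carrier: "V_all ns R Am Ap p \<in> carrier_mat n n"
proof -
  have "V_all ns R Am Ap p \<in> carrier_mat (sum_list ns) (sum_list ns)"
    unfolding V_all_def by (rule diag_block_mat_carrier) (use V_carrier in auto)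
  then show ?thesis unfolding sum_ns .
qed

lemma W_inf_eq:
  assumes j0: "j0 = replicate k (1, 0)" and p: "dim_vec p = n"
  shows "W_inf Q jm j0 jp p = S * cmat (V_all ns R Am Ap p) * mat_adjoint S"
proof -
  \<comment> \<open>No equation has to be solved in the middle group: \<open>V_zero\<close> is the
    weighted sum of the outer squares itself, so \<open>B_tilde_part\<close> already gives the
    congruence.\<close>
  have zero: "W_zero Q jm j0 jp p = S_block 1 * cmat (V_zero ns R p) * mat_adjoint (S_block 1)"
    using B_tilde_part[of 1, OF _ p] unfolding W_zero_semisimple[OF j0] sizes[symmetric] V_zero_def by simp
  let ?Ss = "[S_block 0, S_block 1, S_block 2]"
  let ?Vs = "[V_minus ns R Am p, V_zero ns R p, V_plus ns R Ap p]"
  have S: "map dim_row ?Ss = ns" "map dim_col ?Ss = ns" by (simp_all add: S_block_def)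
  have V: "map dim_row (map cmat ?Vs) = ns" "map dim_col (map cmat ?Vs) = ns"
    using V_carrier[of p] by auto
  have adj: "map dim_row (map mat_adjoint ?Ss) = ns" "map dim_col (map mat_adjoint ?Ss) = ns"
    using S by simp_all
  have SV: "map dim_row (map2 (*) ?Ss (map cmat ?Vs)) = ns" "map dim_col (map2 (*) ?Ss (map cmat ?Vs)) = ns"
    using S V by simp_all
  have "S * cmat (V_all ns R Am Ap p) * mat_adjoint S =
      diag_block_mat (map2 (*) (map2 (*) ?Ss (map cmat ?Vs)) (map mat_adjoint ?Ss))"
    unfolding S_diag_blocks V_all_def map_mat_diag_block_mat[of complex_of_real, OF of_real_0] mat_adjoint_diag_block_mat
      diag_block_mat_mult[OF S V] diag_block_mat_mult[OF SV adj] ..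
  also have "\<dots> = W_inf Q jm j0 jp p"
    unfolding W_inf_def W_minus_eq[OF p] W_plus_eq[OF p] zero by (simp del: diag_block_mat.simps)
  finally show ?thesis ..
qed

section \<open>The Jordan blocks on the imaginary axis\<close>

lemma similar_jordan: "similar_mat (cmat A) (jordan_matrix (jm @ j0 @ jp))"
proof -
  have "jordan_matrix (jm @ j0 @ jp) \<in> carrier_mat n n"
    unfolding Q_jordan[symmetric] using minv_Q(1) Q_carrier A by simp
  then have "similar_mat_wit (jordan_matrix (jm @ j0 @ jp)) (cmat A) (minv Q) Q"
    using minv_Q Q_carrier A by (intro similar_mat_witI[of _ _ n]) (simp_all add: Q_jordan)
  then show ?thesis using similar_mat_sym unfolding similar_mat_def by blast
qed

text \<open>Every block of \<open>j0\<close> has positive size, so its eigenvalue is an eigenvalue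
  of \<open>A\<close> on the imaginary axis and hence zero; semisimplicity then bounds the block
  size.\<close>

lemma j0_semisimple:
  assumes imag_axis: "\<And>l. eigenvalue (cmat A) l \<Longrightarrow> Re l = 0 \<Longrightarrow> l = 0"
    and semisimple: "eigenvalue (cmat A) 0 \<Longrightarrow> semisimple_eigenvalue (cmat A) 0"
  shows "j0 = replicate (length j0) (1, 0)"
proof (rule replicate_eqI)
  fix b assume b: "b \<in> set j0"
  obtain k l where kl: "b = (k, l)" by force
  have mem: "(k, l) \<in> set (jm @ j0 @ jp)" and pos: "k > 0" and Re: "Re l = 0"
    using jordan b unfolding ordered_jordan_decomposition_def kl by auto
  have cA: "cmat A \<in> carrier_mat n n" using A by simp
  have "eigenvalue (cmat A) l"
    by (rule eigenvalue_if_jordan_block[OF cA similar_jordan mem pos])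
  then have l: "l = 0" and ev: "eigenvalue (cmat A) 0" using imag_axis Re by auto
  \<comment> \<open>\<open>semisimple_eigenvalue\<close> speaks about all Jordan normal forms; it is
    instantiated with the given decomposition.\<close>
  have "jordan_nf (cmat A) (jm @ j0 @ jp)"
    using similar_jordan jordan unfolding jordan_nf_def ordered_jordan_decomposition_def by force
  then have "k = 1"
    using semisimple[OF ev] mem unfolding semisimple_eigenvalue_def l by blast
  then show "b = (1, 0)" unfolding kl l by simp
qed simp

section \<open>Comparison of the feasible sets and of the objective functions\<close>

lemma obj_logdet_eq:
  assumes j0: "j0 = replicate k (1, 0)" and p: "dim_vec p = n"
    and pd: "pos_def (cmat (V_all ns R Am Ap p))"
  shows "obj_logdet_W Q jm j0 jp p = obj_logdet_V ns R Am Ap p + (- ln ((cmod (det S))\<^sup>2))"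
proof -
  let ?V = "V_all ns R Am Ap p"
  have V: "cmat ?V \<in> carrier_mat n n" using V_all_carrier by (simp only: map_carrier_mat)
  have aS: "mat_adjoint S \<in> carrier_mat n n" using S_carrier by simp
  have "det (W_inf Q jm j0 jp p) = det S * complex_of_real (det ?V) * cnj (det S)"
    unfolding W_inf_eq[OF j0 p] det_mult[OF mult_carrier_mat[OF S_carrier V] aS]
      det_mult[OF S_carrier V] det_mat_adjoint[OF S_carrier] of_real_hom.hom_det ..
  \<comment> \<open>The determinants of \<open>S\<close> and of its adjoint are conjugate, so their
    product is \<open>|det S|^2\<close>. This is the source of the additive constant.\<close>
  also have "\<dots> = complex_of_real ((cmod (det S))\<^sup>2 * det ?V)"
    using complex_norm_square[of "det S"] by (simp add: ac_simps)
  finally have "Re (det (W_inf Q jm j0 jp p)) = (cmod (det S))\<^sup>2 * det ?V" by simp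
  \<comment> \<open>Together with \<open>det_S\<close> this makes both factors non-zero, so the
    logarithm of the product splits.\<close>
  moreover have "det ?V \<noteq> 0"
    using pos_def_det_nonzero[OF V pd] by (simp add: of_real_hom.hom_det)
  ultimately show ?thesis
    using det_S unfolding obj_logdet_W_def obj_logdet_V_def by (simp add: ln_mult)
qed

lemma pos_def_W_inf_iff:
  assumes "j0 = replicate k (1, 0)" "dim_vec p = n"
  shows "pos_def (W_inf Q jm j0 jp p) \<longleftrightarrow> pos_def (cmat (V_all ns R Am Ap p))"
proof -
  obtain S' where "S' \<in> carrier_mat n n" "S * S' = 1\<^sub>m n"
    using inverse_ofE[OF S_carrier det_S] by blast
  then show ?thesis
    unfolding W_inf_eq[OF assms] using V_all_carrier
    by (intro pos_def_congruence[OF _ S_carrier]) auto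
qed

lemma pos_def_W_minus_iff:
  assumes "dim_vec p = n"
  shows "pos_def (W_minus Q jm j0 jp p) \<longleftrightarrow> pos_def (cmat (V_minus ns R Am p))"
proof -
  obtain S' where "S' \<in> carrier_mat nm nm" "S_block 0 * S' = 1\<^sub>m nm"
    using S_block_inverse[of 0] by auto
  then show ?thesis
    unfolding W_minus_eq[OF assms] using V_carrier(1)[of p] S_block_carrier[of 0]
    by (intro pos_def_congruence[of _ nm]) auto
qed

text \<open>Inverting the congruence \<open>W = S V S^*\<close> for the first block gives
  \<open>S^* W^-1 S = V^-1\<close>: the inverse transforms by the opposite congruence, which cancels
  the change of coordinates in the trace objective.\<close>

lemma minv_W_minus:
  assumes p: "dim_vec p = n" and pd: "pos_def (cmat (V_minus ns R Am p))"
  shows "minv (V_minus ns R Am p) \<in> carrier_mat nm nm"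
    and "minv (W_minus Q jm j0 jp p) \<in> carrier_mat nm nm"
    and "mat_adjoint (S_block 0) * minv (W_minus Q jm j0 jp p) * S_block 0 = cmat (minv (V_minus ns R Am p))"
proof -
  let ?V = "V_minus ns R Am p" and ?S = "S_block 0"
  note V = V_carrier(1)[of p]
  have cV: "cmat ?V \<in> carrier_mat nm nm" using V by (simp only: map_carrier_mat)
  have "det ?V \<noteq> 0" using pos_def_det_nonzero[OF cV pd] by (simp add: of_real_hom.hom_det)
  note iV = minv_inverse[OF V this]
  show "minv ?V \<in> carrier_mat nm nm" by (rule iV(1))
  have ciV: "cmat (minv ?V) \<in> carrier_mat nm nm" using iV(1) by (simp only: map_carrier_mat)
  have V_iV: "cmat ?V * cmat (minv ?V) = 1\<^sub>m nm"
    unfolding cmat_mult[OF V iV(1), symmetric] iV(2) by (rule of_real_hom.mat_hom_one)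
  have S: "?S \<in> carrier_mat nm nm" using S_block_carrier[of 0] by simp
  obtain S' where S': "S' \<in> carrier_mat nm nm" "?S * S' = 1\<^sub>m nm"
    using S_block_inverse[of 0] by auto
  have S'S: "S' * ?S = 1\<^sub>m nm" by (rule mat_mult_left_right_inverse[OF S S'])
  have aS: "mat_adjoint ?S \<in> carrier_mat nm nm" "mat_adjoint S' \<in> carrier_mat nm nm"
    using S S' by simp_all
  have aSS': "mat_adjoint ?S * mat_adjoint S' = 1\<^sub>m nm"
    using mat_adjoint_mult[OF S'(1) S] unfolding S'S by simp
  note assoc = assoc_mult_mat[of _ nm nm _ nm _ nm]
  \<comment> \<open>The expected inverse of the congruence, with the factors inverted and in reverse
    order; \<open>minv_eqI\<close> only asks for it to be a right inverse.\<close>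
  let ?K = "mat_adjoint S' * (cmat (minv ?V) * S')"
  have K: "?K \<in> carrier_mat nm nm" using aS S' ciV by simp
  have W: "W_minus Q jm j0 jp p \<in> carrier_mat nm nm"
    unfolding W_minus_eq[OF p] using S cV aS by simp
  have "W_minus Q jm j0 jp p * ?K =
      ?S * (cmat ?V * ((mat_adjoint ?S * mat_adjoint S') * (cmat (minv ?V) * S')))"
    unfolding W_minus_eq[OF p] using S cV aS ciV S'(1) by (simp add: assoc del: map_carrier_mat mat_adjoint_carrier)
  also have "\<dots> = ?S * ((cmat ?V * cmat (minv ?V)) * S')"
    unfolding aSS' left_mult_one_mat[OF mult_carrier_mat[OF ciV S'(1)]]
    using S cV ciV S'(1) by (simp add: assoc del: map_carrier_mat)
  also have "\<dots> = 1\<^sub>m nm"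
    unfolding V_iV using S'(1) by (simp add: S'(2))
  finally have "minv (W_minus Q jm j0 jp p) = ?K" by (rule minv_eqI[OF W K])
  moreover have "mat_adjoint ?S * ?K * ?S = (mat_adjoint ?S * mat_adjoint S') * (cmat (minv ?V) * (S' * ?S))"
    using S aS ciV S'(1) by (simp add: assoc del: map_carrier_mat mat_adjoint_carrier)
  moreover have "\<dots> = cmat (minv ?V)"
    unfolding aSS' S'S using ciV by simp
  ultimately show "minv (W_minus Q jm j0 jp p) \<in> carrier_mat nm nm"
    "mat_adjoint ?S * minv (W_minus Q jm j0 jp p) * ?S = cmat (minv ?V)"
    using K by simp_all
qed

text \<open>Since \<open>R2\<close> has first block row \<open>(I, O, O)\<close>, the matrix \<open>diag(K, O, O)\<close> is invariant under the
  congruence by \<open>R2\<close>, so only the orthogonal factor \<open>R1\<close> remains.\<close>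
lemma minv_R_diag_first:
  assumes K: "K \<in> carrier_mat nm nm"
  defines "D \<equiv> diag_block_mat [K, 0\<^sub>m n0 n0, 0\<^sub>m np np]"
  shows "(minv R)\<^sup>T * D * minv R = R1 * D * R1\<^sup>T"
proof -
  note assoc = assoc_mult_mat[of _ n n _ n _ n]
  note R1 = schur_blocks(1)
  have DT: "D\<^sup>T = diag_block_mat [K\<^sup>T, 0\<^sub>m n0 n0, 0\<^sub>m np np]"
    unfolding D_def by (rule eq_matI) auto
  have D: "D \<in> carrier_mat n n"
    unfolding D_def using diag_block_mat_carrier[of "[K, 0\<^sub>m n0 n0, 0\<^sub>m np np]" ns] K unfolding sum_ns by auto
  have T: "R1\<^sup>T \<in> carrier_mat n n" "R2\<^sup>T \<in> carrier_mat n n" "R\<^sup>T \<in> carrier_mat n n"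
    "(minv R)\<^sup>T \<in> carrier_mat n n" "D\<^sup>T \<in> carrier_mat n n"
    using R1 R2_carrier R_carrier minv_R(1) D by simp_all
  have D_R2: "D * R2 = D"
    unfolding D_def by (rule diag_first_mult_unit_lower_block3[OF K R2_dims(1,3,2)])
  \<comment> \<open>\<open>K\<close> is not assumed symmetric, so invariance under the transpose of
    \<open>R2\<close> from the left comes from the previous lemma applied to the transpose of
    \<open>K\<close>.\<close>
  have "D\<^sup>T * R2 = D\<^sup>T"
    unfolding DT by (rule diag_first_mult_unit_lower_block3[OF _ R2_dims(1,3,2)]) (use K in simp)
  then have R2_D: "R2\<^sup>T * D = D"
    using transpose_mult[OF T(5) R2_carrier] by simp
  have RT: "R\<^sup>T = R2\<^sup>T * R1\<^sup>T" unfolding R by (rule transpose_mult[OF R1 R2_carrier])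
  have "(minv R)\<^sup>T * R\<^sup>T = 1\<^sub>m n"
    using transpose_mult[OF R_carrier minv_R(1)] unfolding minv_R(2) by simp
  \<comment> \<open>The claim is checked in the opposite direction: congruence of the right-hand
    side by \<open>R\<close> returns \<open>D\<close>, since both inner products of
    \<open>R1\<close> with its transpose collapse. Undoing this congruence needs only that
    \<open>minv R\<close> inverts \<open>R\<close>.\<close>
  have "R\<^sup>T * (R1 * D * R1\<^sup>T) * R = R2\<^sup>T * ((R1\<^sup>T * R1) * (D * ((R1\<^sup>T * R1) * R2)))"
    unfolding RT unfolding R using T R1 R2_carrier D by (simp add: assoc del: transpose_carrier_mat)
  also have "\<dots> = D" unfolding schur_blocks(2) using D R2_carrier D_R2 R2_D by simp
  finally have "(minv R)\<^sup>T * D * minv R = (minv R)\<^sup>T * (R\<^sup>T * (R1 * D * R1\<^sup>T) * R) * minv R" by simp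
  also have "\<dots> = ((minv R)\<^sup>T * R\<^sup>T) * (R1 * D * R1\<^sup>T) * (R * minv R)"
    using T R1 D R_carrier minv_R(1) by (simp add: assoc del: transpose_carrier_mat)
  also have "\<dots> = R1 * D * R1\<^sup>T"
    unfolding \<open>(minv R)\<^sup>T * R\<^sup>T = 1\<^sub>m n\<close> minv_R(2) using R1 D by simp
  finally show ?thesis .
qed

text \<open>With \<open>minv Q = S * minv R\<close>, the factor \<open>S\<close> turns the inverse
  of \<open>W_minus\<close> into that of \<open>V_minus\<close>, and
  \<open>minv_R_diag_first\<close> replaces the remaining factor by an orthogonal conjugation, which
  leaves the trace unchanged.\<close>

lemma obj_trace_eq:
  assumes p: "dim_vec p = n" and pd: "pos_def (cmat (V_minus ns R Am p))"
  shows "obj_trace_W Q jm j0 jp p = obj_trace_V ns R Am p"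
proof -
  note assoc = assoc_mult_mat[of _ n n _ n _ n]
  note iW = minv_W_minus[OF assms]
  let ?Z = "[0\<^sub>m n0 n0, 0\<^sub>m np np]"
  define K where "K = diag_block_mat (minv (W_minus Q jm j0 jp p) # ?Z)"
  define D where "D = diag_block_mat (minv (V_minus ns R Am p) # ?Z)"
  have blocks: "map dim_row (minv (W_minus Q jm j0 jp p) # ?Z) = ns" "map dim_col (minv (W_minus Q jm j0 jp p) # ?Z) = ns"
    "map dim_row (minv (V_minus ns R Am p) # ?Z) = ns" "map dim_col (minv (V_minus ns R Am p) # ?Z) = ns"
    using iW(1,2) by auto
  have K: "K \<in> carrier_mat n n" and D: "D \<in> carrier_mat n n"
    unfolding K_def D_def using diag_block_mat_carrier[OF blocks(1,2)] diag_block_mat_carrier[OF blocks(3,4)]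
    unfolding sum_ns by simp_all
  have cR: "cmat (minv R) \<in> carrier_mat n n" and cD: "cmat D \<in> carrier_mat n n"
    and cRT: "cmat (minv R)\<^sup>T \<in> carrier_mat n n"
    using minv_R(1) D by simp_all
  have aS: "mat_adjoint S \<in> carrier_mat n n" using S_carrier by simp
  have "mat_adjoint S * K * S = cmat D"
  proof -
    let ?Ss = "[S_block 0, S_block 1, S_block 2]"
    have Ss: "map dim_row ?Ss = ns" "map dim_col ?Ss = ns" by (simp_all add: S_block_def)
    have adj: "map dim_row (map mat_adjoint ?Ss) = ns" "map dim_col (map mat_adjoint ?Ss) = ns"
      using Ss by simp_all
    let ?SK = "map2 (*) (map mat_adjoint ?Ss) (minv (W_minus Q jm j0 jp p) # ?Z)"
    have SK: "map dim_row ?SK = ns" "map dim_col ?SK = ns" using adj blocks by simp_all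
    have c: "S_block 1 \<in> carrier_mat n0 n0" "S_block 2 \<in> carrier_mat np np"
      "mat_adjoint (S_block 1) \<in> carrier_mat n0 n0" "mat_adjoint (S_block 2) \<in> carrier_mat np np"
      using S_block_carrier[of 1] S_block_carrier[of 2] by simp_all
    have "mat_adjoint S * K * S = diag_block_mat (map2 (*) ?SK ?Ss)"
      unfolding K_def S_diag_blocks mat_adjoint_diag_block_mat
        diag_block_mat_mult[OF adj blocks(1,2)] diag_block_mat_mult[OF SK Ss] ..
    \<comment> \<open>The first block is \<open>minv_W_minus\<close>; the congruences of the two
      zero blocks remain zero.\<close>
    also have "map2 (*) ?SK ?Ss = map cmat (minv (V_minus ns R Am p) # ?Z)"
      using iW(3) c by simp
    also have "diag_block_mat \<dots> = cmat D"
      unfolding D_def by (rule map_mat_diag_block_mat[symmetric]) simp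
    finally show ?thesis .
  qed
  have "mat_adjoint (minv Q) * K * minv Q =
      mat_adjoint (cmat (minv R)) * (mat_adjoint S * K * S) * cmat (minv R)"
    unfolding minv_Q_eq mat_adjoint_mult[OF S_carrier cR]
    using S_carrier cR cRT K aS by (simp add: assoc mat_adjoint_cmat del: map_carrier_mat mat_adjoint_carrier)
  also have "\<dots> = cmat ((minv R)\<^sup>T * D * minv R)"
    unfolding \<open>mat_adjoint S * K * S = cmat D\<close> mat_adjoint_cmat
    using cmat_mult[of "(minv R)\<^sup>T * D" n n "minv R" n] cmat_mult[of "(minv R)\<^sup>T" n n D n] minv_R(1) D by simp
  also have "(minv R)\<^sup>T * D * minv R = R1 * (D * R1\<^sup>T)"
    using minv_R_diag_first[OF iW(1)] assoc[OF schur_blocks(1) D, of "R1\<^sup>T"] schur_blocks(1)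
    unfolding D_def by simp
  finally have "obj_trace_W Q jm j0 jp p = Re (mat_trace (cmat (R1 * (D * R1\<^sup>T))))"
    unfolding obj_trace_W_def K_def sizes[symmetric] by simp
  also have "\<dots> = mat_trace (R1 * (D * R1\<^sup>T))"
    using schur_blocks(1) D by (subst mat_trace_cmat) auto
  \<comment> \<open>The cyclic exchange brings \<open>R1\<close> next to its transpose, where the
    product is the identity.\<close>
  also have "\<dots> = mat_trace ((D * R1\<^sup>T) * R1)"
    by (rule mat_trace_mult_commute[of _ n n]) (use schur_blocks(1) D in auto)
  also have "(D * R1\<^sup>T) * R1 = D"
    using assoc[OF D _ schur_blocks(1), of "R1\<^sup>T"] schur_blocks(1,2) D by simp
  also have "mat_trace D = obj_trace_V ns R Am p"
    unfolding D_def obj_trace_V_def by (rule mat_trace_diag_first[OF iW(1)])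
  finally show ?thesis .
qed

end

text \<open>The relation is asked for only on the feasible set \<open>F\<close>, which is where
  positive definiteness makes \<open>obj_logdet_eq\<close> and \<open>obj_trace_eq\<close>
  available.\<close>

lemma optimal_solutions_add_const:
  assumes "\<And>p. p \<in> F \<Longrightarrow> f p = g p + c"
  shows "optimal_solutions F f = optimal_solutions F g"
  using assms unfolding optimal_solutions_def by auto

theorem theorem6:
  fixes n nm n0 np :: nat
    and A R1 Am A0m A0 Apm Ap0 Ap R20m R2p0 R2pm R :: "real mat"
    and Q :: "complex mat"
    and jm j0 jp :: jblocks
  assumes A: "A \<in> carrier_mat n n"
    and jordan: "ordered_jordan_decomposition n (cmat A) Q jm j0 jp"
    and sizes: "nm = total_size jm" "n0 = total_size j0" "np = total_size jp"
    and schur: "block_schur_decomposition n nm n0 np A R1 Am A0m A0 Apm Ap0 Ap"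
    and R2_dims: "R20m \<in> carrier_mat n0 nm" "R2p0 \<in> carrier_mat np n0" "R2pm \<in> carrier_mat np nm"
    and R2_0m: "A0 * R20m - R20m * Am = - A0m"
    and R2_p0: "Ap * R2p0 - R2p0 * A0 = - Ap0"
    and R2_pm: "Ap * R2pm - R2pm * Am = - (Apm + Ap0 * R20m)"
    and R: "R = R1 * lower_block3 (1\<^sub>m nm) R20m (1\<^sub>m n0) R2pm R2p0 (1\<^sub>m np)"
    and imag_axis: "\<And>l. eigenvalue (cmat A) l \<Longrightarrow> Re l = 0 \<Longrightarrow> l = 0"
    and semisimple: "eigenvalue (cmat A) 0 \<Longrightarrow> semisimple_eigenvalue (cmat A) 0"
  shows "optimal_solutions {p \<in> prob_simplex n. pos_def (W_inf Q jm j0 jp p)}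
             (obj_logdet_W Q jm j0 jp)
         = optimal_solutions {p \<in> prob_simplex n. pos_def (cmat (V_all [nm, n0, np] R Am Ap p))}
             (obj_logdet_V [nm, n0, np] R Am Ap)
       \<and> ((\<exists>l. eigenvalue (cmat A) l \<and> Re l < 0) \<longrightarrow>
           optimal_solutions {p \<in> prob_simplex n. pos_def (W_minus Q jm j0 jp p)}
             (obj_trace_W Q jm j0 jp)
         = optimal_solutions {p \<in> prob_simplex n. pos_def (cmat (V_minus [nm, n0, np] R Am p))}
             (obj_trace_V [nm, n0, np] R Am))"
proof -
  interpret jordan_schur n nm n0 np A R1 Am A0m A0 Apm Ap0 Ap R20m R2p0 R2pm R Q jm j0 jp
    by unfold_locales fact+
  have j0: "j0 = replicate (length j0) (1, 0)"
    using j0_semisimple imag_axis semisimple by blast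
  have dim: "dim_vec p = n" if "p \<in> prob_simplex n" for p
    using that by (auto simp: prob_simplex_def)
  have "{p \<in> prob_simplex n. pos_def (W_inf Q jm j0 jp p)} =
      {p \<in> prob_simplex n. pos_def (cmat (V_all [nm, n0, np] R Am Ap p))}"
    using pos_def_W_inf_iff[OF j0] dim by auto
  moreover have "optimal_solutions {p \<in> prob_simplex n. pos_def (cmat (V_all [nm, n0, np] R Am Ap p))}
        (obj_logdet_W Q jm j0 jp) =
      optimal_solutions {p \<in> prob_simplex n. pos_def (cmat (V_all [nm, n0, np] R Am Ap p))}
        (obj_logdet_V [nm, n0, np] R Am Ap)"
    using obj_logdet_eq[OF j0] dim by (intro optimal_solutions_add_const) blast
  moreover have "{p \<in> prob_simplex n. pos_def (W_minus Q jm j0 jp p)} =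
      {p \<in> prob_simplex n. pos_def (cmat (V_minus [nm, n0, np] R Am p))}"
    using pos_def_W_minus_iff dim by auto
  moreover have "optimal_solutions {p \<in> prob_simplex n. pos_def (cmat (V_minus [nm, n0, np] R Am p))}
        (obj_trace_W Q jm j0 jp) =
      optimal_solutions {p \<in> prob_simplex n. pos_def (cmat (V_minus [nm, n0, np] R Am p))}
        (obj_trace_V [nm, n0, np] R Am)"
    \<comment> \<open>The constant is zero because the trace objectives coincide on the feasible
      set.\<close>
    using obj_trace_eq dim by (intro optimal_solutions_add_const[where c = 0]) auto
  ultimately show ?thesis by simp
qed

end
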